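(* Let $G$ be a Milnor regular Lie group (possibly infinite-dimensional, not necessarily connected). Then the space of primitive differential 2-forms on $G$ vanishes: if $\eta$ is a 2-form on $G$ with $m^*\eta = \mathrm{pr}_1^*\eta + \mathrm{pr}_2^*\eta$ on $G\times G$, then $\eta = 0$.
   Context: "Lie group" means a group object in smooth manifolds modelled on real (Hausdorff) locally convex topological vector spaces, with smoothness in the usual sense for locally convex spaces (iterated directional derivatives exist and are jointly continuous). With Lie algebra $\mathfrak{g}=T_eG$, the group $G$ is Milnor regular if for every smooth curve $c\colon[0,1]\to\mathfrak{g}$ there is a (necessarily unique) smooth curve $\gamma_c\colon[0,1]\to G$ with $\gamma_c(0)=e$ and left logarithmic derivative $c$, and the map $C^\infty([0,1],\mathfrak{g})\to G$, $c\mapsto\gamma_c(1)$, is smooth. Differential forms are smooth and real-valued. $m\colon G\times G\to G$ is the multiplication map and $\mathrm{pr}_i\colon G\times G\to G$ is projection onto the $i$-th factor. A differential form $\eta$ on $G$ is called primitive if $m^*\eta = \mathrm{pr}_1^*\eta+\mathrm{pr}_2^*\eta$. *)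

theory Defs
  imports
    "HOL-Analysis.Analysis"
    "HOL-Algebra.Group"
    "HOL-Library.Function_Algebras"
begin

(* Pointwise real vector space structure on function types; sums, differences and 0 of functions
   come from Function_Algebras.  It is used for tangent vectors, for curves of tangent vectors and
   for differential forms. *)

instantiation "fun" :: (type, scaleR) scaleR
begin
definition scaleR_fun_def: "r *\<^sub>R f = (\<lambda>x. r *\<^sub>R f x)"
instance ..
end

instance "fun" :: (type, real_vector) real_vector
  by standard (simp_all add: scaleR_fun_def fun_eq_iff scaleR_add_right scaleR_add_left)


section \<open>Locally convex spaces and smooth maps between them\<close>

(* A topological vector space is given by its topology; the underlying vector space is the topspace,
   a linear subspace of the ambient type. *)

definition locally_convex_space :: "'e::real_vector topology \<Rightarrow> bool" where
  "locally_convex_space E \<longleftrightarrow>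
     subspace (topspace E) \<and>
     Hausdorff_space E \<and>
     continuous_map (prod_topology E E) E (\<lambda>(x, y). x + y) \<and>
     continuous_map (prod_topology euclideanreal E) E (\<lambda>(r, x). r *\<^sub>R x) \<and>
     (\<forall>U. openin E U \<and> 0 \<in> U \<longrightarrow> (\<exists>V. openin E V \<and> 0 \<in> V \<and> convex V \<and> V \<subseteq> U))"

(* The directional derivative of f at x along v takes only those t into account for which
   x + t v lies in D.  If D is open this is the usual two-sided derivative; at the end points of
   the interval D = {0..1} it is the one-sided derivative. *)

definition has_dir_deriv ::
  "'b::real_vector topology \<Rightarrow> 'a::real_vector set \<Rightarrow> ('a \<Rightarrow> 'b) \<Rightarrow> 'a \<Rightarrow> 'a \<Rightarrow> 'b \<Rightarrow> bool" where
  "has_dir_deriv F D f x v l \<longleftrightarrow>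
     limitin F (\<lambda>t. (f (x + t *\<^sub>R v) - f x) /\<^sub>R t) l (at 0 within {t. x + t *\<^sub>R v \<in> D})"

definition dir_deriv ::
  "'b::real_vector topology \<Rightarrow> 'a::real_vector set \<Rightarrow> ('a \<Rightarrow> 'b) \<Rightarrow> 'a \<Rightarrow> 'a \<Rightarrow> 'b" where
  "dir_deriv F D f x v = (THE l. has_dir_deriv F D f x v l)"

fun iter_deriv ::
  "'b::real_vector topology \<Rightarrow> 'a::real_vector set \<Rightarrow> ('a \<Rightarrow> 'b) \<Rightarrow> 'a list \<Rightarrow> 'a \<Rightarrow> 'b" where
  "iter_deriv F D f [] = f"
| "iter_deriv F D f (v # vs) = (\<lambda>x. dir_deriv F D (iter_deriv F D f vs) x v)"

(* Smoothness in the sense of Michal and Bastiani: all iterated directional derivatives exist and,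
   for each k, the map (x, v_0, ..., v_(k-1)) \<mapsto> d^k f (x; v_0, ..., v_(k-1)) is jointly continuous
   on D \<times> E^k.  Meant for D open in E and for D relatively open in the interval {0..1} of the reals. *)

definition lc_smooth_on ::
  "'a::real_vector topology \<Rightarrow> 'a set \<Rightarrow> 'b::real_vector topology \<Rightarrow> ('a \<Rightarrow> 'b) \<Rightarrow> bool" where
  "lc_smooth_on E D F f \<longleftrightarrow>
     (\<forall>vs x v. set vs \<subseteq> topspace E \<and> x \<in> D \<and> v \<in> topspace E \<longrightarrow>
        (\<exists>l. has_dir_deriv F D (iter_deriv F D f vs) x v l)) \<and>
     (\<forall>k::nat. continuous_map
        (prod_topology (subtopology E D) (product_topology (\<lambda>_. E) {..<k})) F
        (\<lambda>(x, w). iter_deriv F D f (map w [0..<k]) x))"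


section \<open>Manifolds modelled on locally convex spaces\<close>

(* A chart is its domain together with the coordinate map (only relevant on the domain). *)

type_synonym ('m, 'e) chart = "'m set \<times> ('m \<Rightarrow> 'e)"

record ('m, 'e) manifold =
  mtop :: "'m topology"
  model :: "'e topology"
  atlas :: "('m, 'e) chart set"

definition smooth_into ::
  "'a::real_vector topology \<Rightarrow> 'a set \<Rightarrow> ('m, 'e::real_vector) manifold \<Rightarrow> ('a \<Rightarrow> 'm) \<Rightarrow> bool" where
  "smooth_into E D M f \<longleftrightarrow>
     continuous_map (subtopology E D) (mtop M) f \<and>
     (\<forall>(U, \<phi>) \<in> atlas M. lc_smooth_on E (D \<inter> f -` U) (model M) (\<phi> \<circ> f))"

definition smooth_manifold :: "('m, 'e::real_vector) manifold \<Rightarrow> bool" where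
  "smooth_manifold M \<longleftrightarrow>
     locally_convex_space (model M) \<and>
     Hausdorff_space (mtop M) \<and>
     \<Union> (fst ` atlas M) = topspace (mtop M) \<and>
     (\<forall>(U, \<phi>) \<in> atlas M.
        openin (mtop M) U \<and>
        openin (model M) (\<phi> ` U) \<and>
        homeomorphic_map (subtopology (mtop M) U) (subtopology (model M) (\<phi> ` U)) \<phi>) \<and>
     (\<forall>(U, \<phi>) \<in> atlas M. \<forall>(V, \<psi>) \<in> atlas M.
        lc_smooth_on (model M) (\<phi> ` (U \<inter> V)) (model M) (\<psi> \<circ> inv_into U \<phi>))"

definition smooth_map ::
  "('m, 'e::real_vector) manifold \<Rightarrow> ('n, 'f::real_vector) manifold \<Rightarrow> ('m \<Rightarrow> 'n) \<Rightarrow> bool" where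
  "smooth_map M N f \<longleftrightarrow>
     (\<forall>(U, \<phi>) \<in> atlas M. smooth_into (model M) (\<phi> ` U) N (f \<circ> inv_into U \<phi>))"

definition product_manifold ::
  "('m, 'e) manifold \<Rightarrow> ('n, 'f) manifold \<Rightarrow> ('m \<times> 'n, 'e \<times> 'f) manifold" where
  "product_manifold M N =
     \<lparr> mtop = prod_topology (mtop M) (mtop N),
       model = prod_topology (model M) (model N),
       atlas = {(U \<times> V, map_prod \<phi> \<psi>) | U \<phi> V \<psi>. (U, \<phi>) \<in> atlas M \<and> (V, \<psi>) \<in> atlas N} \<rparr>"


section \<open>Tangent vectors\<close>

(* The class of pairs (chart at x, vector in the model space) under change of charts is the graph
   of a function on the charts at x.  A tangent vector at x is this function, i.e. the family of its
   coordinate representations, extended by 0 to everything that is not a chart at x. *)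

type_synonym ('m, 'e) tvec = "('m, 'e) chart \<Rightarrow> 'e"

definition charts_at :: "('m, 'e) manifold \<Rightarrow> 'm \<Rightarrow> ('m, 'e) chart set" where
  "charts_at M x = {c \<in> atlas M. x \<in> fst c}"

definition tangent_space :: "('m, 'e::real_vector) manifold \<Rightarrow> 'm \<Rightarrow> ('m, 'e) tvec set" where
  "tangent_space M x =
     {v. (\<forall>c \<in> charts_at M x. v c \<in> topspace (model M)) \<and>
         (\<forall>(U, \<phi>) \<in> charts_at M x. \<forall>(V, \<psi>) \<in> charts_at M x.
            v (V, \<psi>) =
              dir_deriv (model M) (\<phi> ` (U \<inter> V)) (\<psi> \<circ> inv_into U \<phi>) (\<phi> x) (v (U, \<phi>))) \<and>
         (\<forall>c. c \<notin> charts_at M x \<longrightarrow> v c = 0)}"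

(* The tangent vector at x whose representation in the chart (U, \<phi>) is a. *)

definition chart_vector ::
  "('m, 'e::real_vector) manifold \<Rightarrow> ('m, 'e) chart \<Rightarrow> 'm \<Rightarrow> 'e \<Rightarrow> ('m, 'e) tvec" where
  "chart_vector M = (\<lambda>(U, \<phi>) x a (V, \<psi>).
     if (V, \<psi>) \<in> charts_at M x
     then dir_deriv (model M) (\<phi> ` (U \<inter> V)) (\<psi> \<circ> inv_into U \<phi>) (\<phi> x) a else 0)"

(* The choice of the chart (U, \<phi>) in the following two definitions is immaterial on a smooth
   manifold. *)

definition tangent_topology ::
  "('m, 'e::real_vector) manifold \<Rightarrow> 'm \<Rightarrow> ('m, 'e) tvec topology" where
  "tangent_topology M x =
     pullback_topology (tangent_space M x) (\<lambda>v. v (SOME c. c \<in> charts_at M x)) (model M)"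

definition tangent_map ::
  "('m, 'e::real_vector) manifold \<Rightarrow> ('n, 'f::real_vector) manifold \<Rightarrow> ('m \<Rightarrow> 'n) \<Rightarrow> 'm \<Rightarrow>
   ('m, 'e) tvec \<Rightarrow> ('n, 'f) tvec" where
  "tangent_map M N f x v =
     (let (U, \<phi>) = (SOME c. c \<in> charts_at M x)
      in (\<lambda>(V, \<psi>).
        if (V, \<psi>) \<in> charts_at N (f x)
        then dir_deriv (model N) (\<phi> ` (U \<inter> f -` V)) (\<psi> \<circ> f \<circ> inv_into U \<phi>) (\<phi> x) (v (U, \<phi>))
        else 0))"

(* The velocity vector at time t of a curve defined on the interval I. *)

definition velocity ::
  "('m, 'e::real_vector) manifold \<Rightarrow> real set \<Rightarrow> (real \<Rightarrow> 'm) \<Rightarrow> real \<Rightarrow> ('m, 'e) tvec" where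
  "velocity M I \<gamma> t = (\<lambda>(V, \<psi>).
     if (V, \<psi>) \<in> charts_at M (\<gamma> t)
     then dir_deriv (model M) (I \<inter> \<gamma> -` V) (\<psi> \<circ> \<gamma>) t 1 else 0)"


section \<open>Differential 2-forms\<close>

(* A 2-form is extended by 0 to arguments that are not a point and two tangent vectors there, so
   that equality and addition of 2-forms are those of functions. *)

type_synonym ('m, 'e) form2 = "'m \<Rightarrow> ('m, 'e) tvec \<Rightarrow> ('m, 'e) tvec \<Rightarrow> real"

definition two_form :: "('m, 'e::real_vector) manifold \<Rightarrow> ('m, 'e) form2 \<Rightarrow> bool" where
  "two_form M \<eta> \<longleftrightarrow>
     (\<forall>x v w. \<not> (x \<in> topspace (mtop M) \<and> v \<in> tangent_space M x \<and> w \<in> tangent_space M x)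
        \<longrightarrow> \<eta> x v w = 0) \<and>
     (\<forall>x \<in> topspace (mtop M).
        (\<forall>u \<in> tangent_space M x. \<forall>v \<in> tangent_space M x. \<forall>w \<in> tangent_space M x. \<forall>r s.
           \<eta> x (r *\<^sub>R u + s *\<^sub>R v) w = r * \<eta> x u w + s * \<eta> x v w \<and>
           \<eta> x w (r *\<^sub>R u + s *\<^sub>R v) = r * \<eta> x w u + s * \<eta> x w v) \<and>
        (\<forall>v \<in> tangent_space M x. \<eta> x v v = 0)) \<and>
     (\<forall>(U, \<phi>) \<in> atlas M.
        lc_smooth_on
          (prod_topology (model M) (prod_topology (model M) (model M)))
          (\<phi> ` U \<times> topspace (model M) \<times> topspace (model M))
          euclideanreal
          (\<lambda>(y, a, b). let x = inv_into U \<phi> y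
             in \<eta> x (chart_vector M (U, \<phi>) x a) (chart_vector M (U, \<phi>) x b)))"

definition pullback_form ::
  "('m, 'e::real_vector) manifold \<Rightarrow> ('n, 'f::real_vector) manifold \<Rightarrow> ('m \<Rightarrow> 'n) \<Rightarrow>
   ('n, 'f) form2 \<Rightarrow> ('m, 'e) form2" where
  "pullback_form M N f \<eta> = (\<lambda>x v w.
     if x \<in> topspace (mtop M) \<and> v \<in> tangent_space M x \<and> w \<in> tangent_space M x
     then \<eta> (f x) (tangent_map M N f x v) (tangent_map M N f x w) else 0)"


section \<open>Lie groups and Milnor regularity\<close>

definition lie_group :: "('g, 'a) monoid_scheme \<Rightarrow> ('g, 'e::real_vector) manifold \<Rightarrow> bool" where
  "lie_group G M \<longleftrightarrow>
     group G \<and> smooth_manifold M \<and> topspace (mtop M) = carrier G \<and>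
     smooth_map (product_manifold M M) M (\<lambda>(x, y). x \<otimes>\<^bsub>G\<^esub> y) \<and>
     smooth_map M M (\<lambda>x. inv\<^bsub>G\<^esub> x)"

abbreviation lie_algebra ::
  "('g, 'a) monoid_scheme \<Rightarrow> ('g, 'e::real_vector) manifold \<Rightarrow> ('g, 'e) tvec topology" where
  "lie_algebra G M \<equiv> tangent_topology M \<one>\<^bsub>G\<^esub>"

(* Smooth curves [0,1] \<rightarrow> E, extended by 0 to the real line. *)

definition smooth_curves :: "'e::real_vector topology \<Rightarrow> (real \<Rightarrow> 'e) set" where
  "smooth_curves E =
     {c. lc_smooth_on euclideanreal {0..1} E c \<and> (\<forall>t. t \<notin> {0..1} \<longrightarrow> c t = 0)}"

(* The topology of C^\<infinity>([0,1], E): uniform convergence of all derivatives, i.e. the coarsest topology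
   for which all maps c \<mapsto> c^(k) into C([0,1], E) with the compact-open topology are continuous. *)

definition smooth_curve_topology :: "'e::real_vector topology \<Rightarrow> (real \<Rightarrow> 'e) topology" where
  "smooth_curve_topology E = topology_generated_by
     {{c \<in> smooth_curves E. iter_deriv E {0..1} c (replicate k 1) ` K \<subseteq> U} | k K U.
        compact K \<and> K \<subseteq> {0..1} \<and> openin E U}"

definition left_log_deriv ::
  "('g, 'a) monoid_scheme \<Rightarrow> ('g, 'e::real_vector) manifold \<Rightarrow> (real \<Rightarrow> 'g) \<Rightarrow> real \<Rightarrow>
   ('g, 'e) tvec" where
  "left_log_deriv G M \<gamma> t =
     tangent_map M M (\<lambda>x. inv\<^bsub>G\<^esub> (\<gamma> t) \<otimes>\<^bsub>G\<^esub> x) (\<gamma> t) (velocity M {0..1} \<gamma> t)"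

definition is_evolution ::
  "('g, 'a) monoid_scheme \<Rightarrow> ('g, 'e::real_vector) manifold \<Rightarrow> (real \<Rightarrow> ('g, 'e) tvec) \<Rightarrow>
   (real \<Rightarrow> 'g) \<Rightarrow> bool" where
  "is_evolution G M c \<gamma> \<longleftrightarrow>
     smooth_into euclideanreal {0..1} M \<gamma> \<and> \<gamma> 0 = \<one>\<^bsub>G\<^esub> \<and>
     (\<forall>t \<in> {0..1}. left_log_deriv G M \<gamma> t = c t)"

definition milnor_regular ::
  "('g, 'a) monoid_scheme \<Rightarrow> ('g, 'e::real_vector) manifold \<Rightarrow> bool" where
  "milnor_regular G M \<longleftrightarrow>
     (\<exists>Evol. (\<forall>c \<in> smooth_curves (lie_algebra G M). is_evolution G M c (Evol c)) \<and>
        smooth_into (smooth_curve_topology (lie_algebra G M)) (smooth_curves (lie_algebra G M)) M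
          (\<lambda>c. Evol c 1))"

definition primitive_form ::
  "('g, 'a) monoid_scheme \<Rightarrow> ('g, 'e::real_vector) manifold \<Rightarrow> ('g, 'e) form2 \<Rightarrow> bool" where
  "primitive_form G M \<eta> \<longleftrightarrow>
     pullback_form (product_manifold M M) M (\<lambda>(x, y). x \<otimes>\<^bsub>G\<^esub> y) \<eta> =
     pullback_form (product_manifold M M) M fst \<eta> + pullback_form (product_manifold M M) M snd \<eta>"

end

theory Submission
  imports Defs
begin

text \<open>
  The identity \<open>m\<^sup>*\<eta> = pr\<^sub>1\<^sup>*\<eta> + pr\<^sub>2\<^sup>*\<eta>\<close> is tested at the point \<open>(g, e)\<close> on one vector \<open>(v, 0)\<close> of the
  first factor and one vector \<open>(0, u)\<close> of the second factor.  On the right, each summand has a zero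
  argument, because \<open>pr\<^sub>1\<close> kills \<open>(0, u)\<close> and \<open>pr\<^sub>2\<close> kills \<open>(v, 0)\<close>.  On the left, \<open>m\<close> sends \<open>(v, 0)\<close>
  to \<open>v\<close> and \<open>(0, u)\<close> to the left translate of \<open>u\<close> by \<open>g\<close>.  Hence \<open>\<eta>\<close> at \<open>g\<close> vanishes on \<open>v\<close> and
  the translate of \<open>u\<close>.  Left translation by \<open>g\<close> is a diffeomorphism, so every tangent vector \<open>w\<close> at
  \<open>g\<close> is such a translate, with \<open>u\<close> the translate of \<open>w\<close> by the inverse of \<open>g\<close>.

  The work lies in the differential calculus behind this argument.  Tangent vectors are handled as
  velocities of curves: \<open>represents M \<gamma> p v\<close> says that \<open>\<gamma>\<close> passes through \<open>p\<close> with velocity \<open>v\<close>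
  in every chart.  Every tangent vector is represented by a line in a chart
  (\<open>chart_line_represents\<close>), and tangent maps push representing curves forward
  (\<open>represents_smooth_image\<close>).  The vectors needed above are then computed from curves in the group
  alone: if \<open>\<delta>\<close> represents \<open>w\<close>, then multiplying \<open>\<delta>\<close> by the inverse of \<open>g\<close> and again by \<open>g\<close> gives
  \<open>\<delta>\<close> back, and a curve represents at most one vector.

  Pushing curves forward is the chain rule \<open>chain_rule_curve\<close> for a smooth map and a curve that is
  differentiable at one point.  In a locally convex space it follows from joint continuity of the
  derivative and a mean value theorem, \<open>mean_value_convex_open\<close>, whose proof is a subdivision of the
  interval.
\<close>

section \<open>Calculus in locally convex spaces\<close>

lemma locally_convex_space_subspace: "locally_convex_space E \<Longrightarrow> subspace (topspace E)"
  and locally_convex_space_Hausdorff: "locally_convex_space E \<Longrightarrow> Hausdorff_space E"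
  and locally_convex_space_add:
    "locally_convex_space E \<Longrightarrow> continuous_map (prod_topology E E) E (\<lambda>(x, y). x + y)"
  and locally_convex_space_scaleR:
    "locally_convex_space E \<Longrightarrow> continuous_map (prod_topology euclideanreal E) E (\<lambda>(r, x). r *\<^sub>R x)"
  by (auto simp: locally_convex_space_def)

lemma locally_convex_space_nbhd_0:
  assumes "locally_convex_space E" "openin E U" "0 \<in> U"
  obtains V where "openin E V" "0 \<in> V" "convex V" "V \<subseteq> U"
  using assms unfolding locally_convex_space_def by blast

lemma openin_translation_preimage:
  assumes E: "locally_convex_space E" and a: "a \<in> topspace E" and U: "openin E U"
  shows "openin E {x \<in> topspace E. a + x \<in> U}"
proof -
  have "continuous_map E (prod_topology E E) (\<lambda>x. (a, x))"
    using a by (simp add: continuous_map_paired)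
  from openin_continuous_map_preimage[OF continuous_map_compose[OF this
      locally_convex_space_add[OF E]] U]
  show ?thesis by simp
qed

lemma locally_convex_space_nbhd:
  assumes E: "locally_convex_space E" and U: "openin E U" and x: "x \<in> U"
  obtains V where "openin E V" "x \<in> V" "convex V" "V \<subseteq> U"
proof -
  have xE: "x \<in> topspace E" using U x openin_subset by blast
  have sub: "subspace (topspace E)" using E by (rule locally_convex_space_subspace)
  obtain V where V: "openin E V" "0 \<in> V" "convex V" "V \<subseteq> {y \<in> topspace E. x + y \<in> U}"
    by (rule locally_convex_space_nbhd_0[OF E openin_translation_preimage[OF E xE U]])
       (use x sub in \<open>auto simp: subspace_0\<close>)
  \<comment> \<open>The translate of \<open>V\<close> is open because it is a preimage under the inverse translation.\<close>
  have eq: "{y \<in> topspace E. - x + y \<in> V} = (+) x ` V"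
  proof (intro equalityI subsetI)
    fix y assume "y \<in> {y \<in> topspace E. - x + y \<in> V}"
    then show "y \<in> (+) x ` V" by (intro image_eqI[of _ _ "- x + y"]) auto
  next
    fix y assume "y \<in> (+) x ` V"
    then show "y \<in> {y \<in> topspace E. - x + y \<in> V}"
      using V(4) xE sub by (auto intro: subspace_add)
  qed
  show thesis
  proof
    show "openin E ((+) x ` V)"
      unfolding eq[symmetric]
      by (rule openin_translation_preimage[OF E _ V(1)]) (use xE sub in \<open>auto intro: subspace_neg\<close>)
    show "x \<in> (+) x ` V" using V(2) by (intro image_eqI[of _ _ 0]) auto
    show "convex ((+) x ` V)" using V(3) by (rule convex_translation)
    show "(+) x ` V \<subseteq> U" using V(4) by auto
  qed
qed

lemma locally_convex_space_prod:
  fixes E :: "'e::real_vector topology" and F :: "'f::real_vector topology"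
  assumes E: "locally_convex_space E" and F: "locally_convex_space F"
  shows "locally_convex_space (prod_topology E F)"
  unfolding locally_convex_space_def
proof (intro conjI allI impI)
  show "subspace (topspace (prod_topology E F))"
    using E F by (simp add: locally_convex_space_subspace subspace_Times)
  show "Hausdorff_space (prod_topology E F)"
    using E F by (simp add: Hausdorff_space_prod_topology locally_convex_space_Hausdorff)
  note projections = continuous_map_fst continuous_map_snd
    continuous_map_compose[OF continuous_map_fst continuous_map_fst, unfolded o_def]
    continuous_map_compose[OF continuous_map_fst continuous_map_snd, unfolded o_def]
    continuous_map_compose[OF continuous_map_snd continuous_map_fst, unfolded o_def]
    continuous_map_compose[OF continuous_map_snd continuous_map_snd, unfolded o_def]
  have "continuous_map (prod_topology (prod_topology E F) (prod_topology E F)) E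
          ((\<lambda>(x, y). x + y) \<circ> (\<lambda>p. (fst (fst p), fst (snd p))))"
    by (rule continuous_map_compose[OF _ locally_convex_space_add[OF E]])
       (simp add: continuous_map_paired projections)
  moreover have "continuous_map (prod_topology (prod_topology E F) (prod_topology E F)) F
          ((\<lambda>(x, y). x + y) \<circ> (\<lambda>p. (snd (fst p), snd (snd p))))"
    by (rule continuous_map_compose[OF _ locally_convex_space_add[OF F]])
       (simp add: continuous_map_paired projections)
  ultimately show "continuous_map (prod_topology (prod_topology E F) (prod_topology E F))
      (prod_topology E F) (\<lambda>(x, y). x + y)"
    by (simp add: continuous_map_pairwise o_def case_prod_unfold)
  have "continuous_map (prod_topology euclideanreal (prod_topology E F)) E
          ((\<lambda>(r, x). r *\<^sub>R x) \<circ> (\<lambda>p. (fst p, fst (snd p))))"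
    by (rule continuous_map_compose[OF _ locally_convex_space_scaleR[OF E]])
       (simp add: continuous_map_paired projections)
  moreover have "continuous_map (prod_topology euclideanreal (prod_topology E F)) F
          ((\<lambda>(r, x). r *\<^sub>R x) \<circ> (\<lambda>p. (fst p, snd (snd p))))"
    by (rule continuous_map_compose[OF _ locally_convex_space_scaleR[OF F]])
       (simp add: continuous_map_paired projections)
  ultimately show "continuous_map (prod_topology euclideanreal (prod_topology E F))
      (prod_topology E F) (\<lambda>(r, x). r *\<^sub>R x)"
    by (simp add: continuous_map_pairwise o_def case_prod_unfold)
next
  fix U assume U: "openin (prod_topology E F) U \<and> 0 \<in> U"
  then obtain A B where A: "openin E A" "0 \<in> A" and B: "openin F B" "0 \<in> B" and AB: "A \<times> B \<subseteq> U"
    unfolding openin_prod_topology_alt zero_prod_def by blast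
  obtain A' where A': "openin E A'" "0 \<in> A'" "convex A'" "A' \<subseteq> A"
    using E A by (rule locally_convex_space_nbhd_0)
  obtain B' where B': "openin F B'" "0 \<in> B'" "convex B'" "B' \<subseteq> B"
    using F B by (rule locally_convex_space_nbhd_0)
  show "\<exists>V. openin (prod_topology E F) V \<and> 0 \<in> V \<and> convex V \<and> V \<subseteq> U"
    using A' B' AB
    by (intro exI[of _ "A' \<times> B'"]) (auto simp: openin_prod_Times_iff zero_prod_def convex_Times)
qed

text \<open>
  Derivatives along a curve, at parameter 0 only.  Directional derivatives are the case of a straight
  line, see \<open>has_dir_deriv_iff_curve_deriv\<close>.
\<close>

definition curve_deriv :: "'e::real_vector topology \<Rightarrow> (real \<Rightarrow> 'e) \<Rightarrow> 'e \<Rightarrow> bool" where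
  "curve_deriv E c l \<longleftrightarrow> limitin E (\<lambda>t. (c t - c 0) /\<^sub>R t) l (at 0)"

lemma curve_deriv_unique:
  assumes "Hausdorff_space E" "curve_deriv E c l" "curve_deriv E c l'"
  shows "l = l'"
  by (rule limitin_Hausdorff_unique[OF assms(2,3)[unfolded curve_deriv_def] at_neq_bot assms(1)])

lemma curve_deriv_cong:
  assumes "eventually (\<lambda>t. c t = c' t) (at 0)" "c 0 = c' 0" "curve_deriv E c l"
  shows "curve_deriv E c' l"
  using assms(3) unfolding curve_deriv_def
  by (rule limitin_transform_eventually[rotated])
     (rule eventually_mono[OF assms(1)], simp add: assms(2))

lemma curve_deriv_pair:
  "curve_deriv (prod_topology E F) (\<lambda>t. (c t, d t)) (k, l) \<longleftrightarrow> curve_deriv E c k \<and> curve_deriv F d l"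
  by (simp add: curve_deriv_def limitin_pairwise o_def)

lemma curve_deriv_const:
  "locally_convex_space E \<Longrightarrow> curve_deriv E (\<lambda>t. a) 0"
  unfolding curve_deriv_def
  by (rule limitin_eventually) (auto simp: locally_convex_space_subspace subspace_0)

lemma curve_deriv_line:
  "v \<in> topspace E \<Longrightarrow> curve_deriv E (\<lambda>t. x + t *\<^sub>R v) v"
  unfolding curve_deriv_def
  by (rule limitin_eventually) (auto simp: eventually_at_filter)

text \<open>
  A curve differentiable at 0 is continuous there, since \<open>c t\<close> is \<open>c 0 + t q(t)\<close> with a convergent
  difference quotient \<open>q\<close> and the vector space operations are jointly continuous.
\<close>

lemma curve_deriv_imp_limit:
  assumes E: "locally_convex_space E" and c: "curve_deriv E c l" and x: "c 0 \<in> topspace E"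
  shows "limitin E c (c 0) (at 0)"
proof -
  have 1: "limitin (prod_topology euclideanreal E) (\<lambda>t. (t, (c t - c 0) /\<^sub>R t)) (0, l) (at 0)"
    using c unfolding curve_deriv_def
    by (simp add: limitin_pairwise o_def flip: tendsto_def) 
  have 2: "limitin E ((\<lambda>(r, x). r *\<^sub>R x) \<circ> (\<lambda>t. (t, (c t - c 0) /\<^sub>R t))) 0 (at 0)"
    using continuous_map_limit[OF locally_convex_space_scaleR[OF E] 1] by simp
  have 3: "limitin (prod_topology E E)
      (\<lambda>t. (c 0, ((\<lambda>(r, x). r *\<^sub>R x) \<circ> (\<lambda>t. (t, (c t - c 0) /\<^sub>R t))) t)) (c 0, 0) (at 0)"
    using 2 x by (simp add: limitin_pairwise o_def)
  have "limitin E (\<lambda>t. c 0 + t *\<^sub>R ((c t - c 0) /\<^sub>R t)) (c 0) (at 0)"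
    using continuous_map_limit[OF locally_convex_space_add[OF E] 3] by (simp add: o_def)
  then show ?thesis
    by (rule limitin_transform_eventually[rotated]) (auto simp: eventually_at_filter)
qed

lemma eventually_line_in_open:
  assumes E: "locally_convex_space E" and D: "openin E D" and x: "x \<in> D" and v: "v \<in> topspace E"
  shows "eventually (\<lambda>t. x + t *\<^sub>R v \<in> D) (at 0)"
proof -
  have "x \<in> topspace E" using D x openin_subset by blast
  then have "limitin E (\<lambda>t. x + t *\<^sub>R v) x (at 0)"
    using curve_deriv_imp_limit[OF E curve_deriv_line[OF v], of x] by simp
  then show ?thesis using D x by (rule limitinD)
qed

text \<open>
  Restricting the parameter to those \<open>t\<close> with \<open>x + t v \<in> D\<close> does not affect the limit at 0 when this
  holds for all small \<open>t\<close>; on open sets the domain can thus be forgotten.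
\<close>

lemma has_dir_deriv_iff_curve_deriv:
  assumes "eventually (\<lambda>t. x + t *\<^sub>R v \<in> D) (at 0)"
  shows "has_dir_deriv F D f x v l \<longleftrightarrow> curve_deriv F (\<lambda>t. f (x + t *\<^sub>R v)) l"
proof -
  have "at 0 within {t. x + t *\<^sub>R v \<in> D} = at 0"
    unfolding filter_eq_iff
  proof (intro allI iffI)
    fix P :: "real \<Rightarrow> bool"
    assume "eventually P (at 0 within {t. x + t *\<^sub>R v \<in> D})"
    then show "eventually P (at 0)"
      using assms unfolding eventually_at_filter by eventually_elim simp
  next
    fix P :: "real \<Rightarrow> bool"
    assume "eventually P (at 0)"
    then show "eventually P (at 0 within {t. x + t *\<^sub>R v \<in> D})"
      unfolding eventually_at_filter by eventually_elim simp
  qed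
  then show ?thesis
    by (simp add: has_dir_deriv_def curve_deriv_def)
qed

lemma dir_deriv_eqI:
  assumes "Hausdorff_space F" "eventually (\<lambda>t. x + t *\<^sub>R v \<in> D) (at 0)"
    and "curve_deriv F (\<lambda>t. f (x + t *\<^sub>R v)) l"
  shows "dir_deriv F D f x v = l"
  unfolding dir_deriv_def
proof (rule the_equality)
  show "has_dir_deriv F D f x v l"
    using has_dir_deriv_iff_curve_deriv[OF assms(2), where f = f] assms(3) by (rule iffD2)
next
  fix l' assume "has_dir_deriv F D f x v l'"
  then have "curve_deriv F (\<lambda>t. f (x + t *\<^sub>R v)) l'"
    by (rule has_dir_deriv_iff_curve_deriv[OF assms(2), where f = f, THEN iffD1])
  then show "l' = l" by (rule curve_deriv_unique[OF assms(1) _ assms(3)])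
qed

lemma lc_smooth_on_curve_deriv:
  assumes E: "locally_convex_space E" and F: "Hausdorff_space F" and D: "openin E D"
    and f: "lc_smooth_on E D F f" and x: "x \<in> D" and v: "v \<in> topspace E"
  shows "curve_deriv F (\<lambda>t. f (x + t *\<^sub>R v)) (dir_deriv F D f x v)"
proof -
  have ev: "eventually (\<lambda>t. x + t *\<^sub>R v \<in> D) (at 0)"
    using E D x v by (rule eventually_line_in_open)
  obtain l where "has_dir_deriv F D f x v l"
    using f[unfolded lc_smooth_on_def, THEN conjunct1, rule_format, of "[]" x v] x v by auto
  then have l: "curve_deriv F (\<lambda>t. f (x + t *\<^sub>R v)) l"
    by (rule has_dir_deriv_iff_curve_deriv[OF ev, where f = f, THEN iffD1])
  with dir_deriv_eqI[OF F ev l] show ?thesis by simp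
qed

text \<open>
  The case \<open>k = 1\<close> of joint continuity, with a single direction in place of a family of length one.
\<close>

lemma lc_smooth_on_continuous_dir_deriv:
  assumes f: "lc_smooth_on E D F f"
  shows "continuous_map (prod_topology (subtopology E D) E) F (\<lambda>(x, v). dir_deriv F D f x v)"
proof -
  have 1: "continuous_map (prod_topology (subtopology E D) (product_topology (\<lambda>_. E) {..<1::nat})) F
        (\<lambda>(x, w). iter_deriv F D f (map w [0..<1]) x)"
    using f unfolding lc_smooth_on_def by (elim conjE allE)
  have 2: "continuous_map (prod_topology (subtopology E D) E)
      (prod_topology (subtopology E D) (product_topology (\<lambda>_. E) {..<1::nat}))
      (\<lambda>p. (fst p, \<lambda>i\<in>{..<1}. snd p))"
    unfolding continuous_map_paired continuous_map_componentwise
    by (simp add: continuous_map_fst continuous_map_snd image_subset_iff)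
  show ?thesis
    using continuous_map_compose[OF 2 1] by (simp add: o_def case_prod_unfold)
qed

text \<open>
  Mean value theorem without norms or functionals.  Call \<open>[r, t]\<close> good if its difference quotient lies
  in \<open>V\<close>.  Adjacent good intervals have a good union, because the quotient over the union is a convex
  combination of the two quotients.  Short intervals around any point \<open>s\<close> are good, because the
  quotients on both sides of \<open>s\<close> tend to the derivative at \<open>s\<close>, which lies in the open set \<open>V\<close>.
  Bisection then shows that the whole interval is good.
\<close>

lemma mean_value_convex_open:
  fixes h :: "real \<Rightarrow> 'b::real_vector"
  assumes V: "openin F V" "convex V" and ab: "a < b"
    and deriv: "\<And>s. a \<le> s \<Longrightarrow> s \<le> b \<Longrightarrow> \<exists>l\<in>V. curve_deriv F (\<lambda>t. h (s + t)) l"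
  shows "(h b - h a) /\<^sub>R (b - a) \<in> V"
proof -
  \<comment> \<open>Multiplying out the quotient makes degenerate intervals good, as the bisection principle requires.\<close>
  define P where "P = (\<lambda>a b. \<exists>y\<in>V. h b - h a = (b - a) *\<^sub>R y)"
  have "P a b"
    using less_imp_le[OF ab]
  proof (induction rule: Bolzano)
    case (trans r s t)
    then obtain y z where yz: "y \<in> V" "z \<in> V" "h s - h r = (s - r) *\<^sub>R y" "h t - h s = (t - s) *\<^sub>R z"
      unfolding P_def by blast
    show ?case
    proof (cases "r = t")
      case True
      then show ?thesis using yz unfolding P_def by auto
    next
      case False
      with trans have pos: "t - r > 0" by simp
      let ?w = "((s - r) / (t - r)) *\<^sub>R y + ((t - s) / (t - r)) *\<^sub>R z"
      have "?w \<in> V"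
        by (rule convexD[OF V(2) yz(1,2)])
           (use trans pos in \<open>auto simp: add_divide_distrib[symmetric]\<close>)
      moreover have "h t - h r = (t - r) *\<^sub>R ?w"
      proof -
        have "h t - h r = (h s - h r) + (h t - h s)" by simp
        also have "\<dots> = (s - r) *\<^sub>R y + (t - s) *\<^sub>R z" using yz by simp
        also have "\<dots> = (t - r) *\<^sub>R ?w" using pos by (simp add: scaleR_add_right)
        finally show ?thesis .
      qed
      ultimately show ?thesis unfolding P_def by blast
    qed
  next
    case (local s)
    then obtain l where l: "l \<in> V" "curve_deriv F (\<lambda>t. h (s + t)) l" using deriv by blast
    have "eventually (\<lambda>t. (h (s + t) - h s) /\<^sub>R t \<in> V) (at 0)"
      using limitinD[OF l(2)[unfolded curve_deriv_def] V(1) l(1)] by simp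
    then obtain d where d: "d > 0" "\<And>t. t \<noteq> 0 \<Longrightarrow> \<bar>t\<bar> < d \<Longrightarrow> (h (s + t) - h s) /\<^sub>R t \<in> V"
      unfolding eventually_at by (auto simp: dist_real_def)
    have near: "\<exists>y\<in>V. h (s + t) - h s = t *\<^sub>R y" if "\<bar>t\<bar> < d" for t
      using d(2)[of t] that l(1)
      by (cases "t = 0") (auto intro!: bexI[of _ "(h (s + t) - h s) /\<^sub>R t"])
    show ?case
    proof (intro exI[of _ d] conjI allI impI d(1))
      fix r t assume rt: "r \<le> s \<and> s \<le> t \<and> t - r < d"
      obtain y where y: "y \<in> V" "h t - h s = (t - s) *\<^sub>R y"
        using near[of "t - s"] rt by auto
      obtain z where z: "z \<in> V" "h r - h s = (r - s) *\<^sub>R z"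
        using near[of "r - s"] rt by auto
      show "P r t"
      proof (cases "r = t")
        case True
        then show ?thesis using y unfolding P_def by auto
      next
        case False
        with rt have pos: "t - r > 0" by simp
        let ?w = "((s - r) / (t - r)) *\<^sub>R z + ((t - s) / (t - r)) *\<^sub>R y"
        have "?w \<in> V"
          by (rule convexD[OF V(2) z(1) y(1)])
             (use rt pos in \<open>auto simp: add_divide_distrib[symmetric]\<close>)
        moreover have "h t - h r = (t - r) *\<^sub>R ?w"
        proof -
          have "h t - h r = (h t - h s) - (h r - h s)" by simp
          also have "\<dots> = (s - r) *\<^sub>R z + (t - s) *\<^sub>R y"
            using y z by (simp add: algebra_simps)
          also have "\<dots> = (t - r) *\<^sub>R ?w" using pos by (simp add: scaleR_add_right)
          finally show ?thesis .
        qed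
        ultimately show ?thesis unfolding P_def by blast
      qed
    qed
  qed
  then show ?thesis using ab unfolding P_def by auto
qed

text \<open>
  With \<open>w = (c(t) - c(0)) / t\<close>, the difference quotient of \<open>f \<circ> c\<close> at \<open>t\<close> is that of
  \<open>s \<mapsto> f (c(0) + s w)\<close> over the interval between 0 and \<open>t\<close>.  For small \<open>t\<close> the direction \<open>w\<close> is close
  to \<open>v\<close> and the segment from \<open>c(0)\<close> to \<open>c(t)\<close> is close to \<open>c(0)\<close>, so by joint continuity the
  derivatives along the segment lie in a prescribed convex neighbourhood of the derivative of \<open>f\<close> at
  \<open>c(0)\<close> along \<open>v\<close>.  By the mean value theorem so does the quotient.
\<close>

theorem chain_rule_curve:
  assumes E: "locally_convex_space E" and F: "locally_convex_space F" and D: "openin E D"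
    and f: "lc_smooth_on E D F f" and c: "curve_deriv E c v" and x: "c 0 \<in> D"
  shows "curve_deriv F (f \<circ> c) (dir_deriv F D f (c 0) v)"
  unfolding curve_deriv_def limitin_def
proof (intro conjI allI impI)
  let ?df = "\<lambda>(x, v). dir_deriv F D f x v"
  let ?T = "prod_topology (subtopology E D) E"
  have DE: "D \<subseteq> topspace E" using D by (rule openin_subset)
  have vE: "v \<in> topspace E" using c unfolding curve_deriv_def by (rule limitin_topspace)
  have df: "continuous_map ?T F ?df" using f by (rule lc_smooth_on_continuous_dir_deriv)
  show "dir_deriv F D f (c 0) v \<in> topspace F"
    using continuous_map_image_subset_topspace[OF df] x vE DE by auto
  fix W assume W: "openin F W \<and> dir_deriv F D f (c 0) v \<in> W"
  then obtain V where V: "openin F V" "dir_deriv F D f (c 0) v \<in> V" "convex V" "V \<subseteq> W"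
    using locally_convex_space_nbhd[OF F] by blast
  have "openin ?T {p \<in> topspace ?T. ?df p \<in> V}"
    using df V(1) by (rule openin_continuous_map_preimage)
  moreover have "(c 0, v) \<in> {p \<in> topspace ?T. ?df p \<in> V}"
    using x vE DE V(2) by auto
  ultimately obtain A B where A: "openin (subtopology E D) A" "c 0 \<in> A"
    and B: "openin E B" "v \<in> B" and AB: "A \<times> B \<subseteq> {p \<in> topspace ?T. ?df p \<in> V}"
    unfolding openin_prod_topology_alt by blast
  have "openin E A" using A(1) D by (rule openin_trans_full)
  then obtain A' where A': "openin E A'" "c 0 \<in> A'" "convex A'" "A' \<subseteq> A"
    using locally_convex_space_nbhd[OF E _ A(2)] by blast
  have A'D: "A' \<subseteq> D" using A'(4) openin_subset[OF A(1)] by auto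
  have deriv: "\<exists>l\<in>V. curve_deriv F (\<lambda>t. f (y + t *\<^sub>R w)) l" if "y \<in> A'" "w \<in> B" for y w
  proof
    show "dir_deriv F D f y w \<in> V" using AB subsetD[OF A'(4) that(1)] that(2) by auto
    show "curve_deriv F (\<lambda>t. f (y + t *\<^sub>R w)) (dir_deriv F D f y w)"
      using that A'D openin_subset[OF B(1)]
      by (intro lc_smooth_on_curve_deriv[OF E locally_convex_space_Hausdorff[OF F] D f]) auto
  qed
  have evA: "eventually (\<lambda>t. c t \<in> A') (at 0)"
    by (rule limitinD[OF curve_deriv_imp_limit[OF E c] A'(1,2)]) (use x DE in blast)
  have evB: "eventually (\<lambda>t. (c t - c 0) /\<^sub>R t \<in> B) (at 0)"
    using c[unfolded curve_deriv_def] B by (rule limitinD)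
  have ev0: "eventually (\<lambda>t. t \<noteq> 0) (at (0::real))"
    by (simp add: eventually_at_filter)
  show "eventually (\<lambda>t. ((f \<circ> c) t - (f \<circ> c) 0) /\<^sub>R t \<in> W) (at 0)"
    using evA evB ev0
  proof eventually_elim
    case (elim t)
    define w where "w = (c t - c 0) /\<^sub>R t"
    define h where "h = (\<lambda>s. f (c 0 + s *\<^sub>R w))"
    have ct: "c t = c 0 + t *\<^sub>R w" using elim(3) by (simp add: w_def)
    \<comment> \<open>The two bounds say that \<open>s\<close> lies between 0 and \<open>t\<close>, for either sign of \<open>t\<close>.\<close>
    have hd: "\<exists>l\<in>V. curve_deriv F (\<lambda>\<tau>. h (s + \<tau>)) l" if "s / t \<ge> 0" "s / t \<le> 1" for s
    proof -
      have "(1 - s / t) *\<^sub>R c 0 + (s / t) *\<^sub>R c t \<in> A'"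
        by (rule convexD[OF A'(3,2) elim(1)]) (use that in auto)
      also have "(1 - s / t) *\<^sub>R c 0 + (s / t) *\<^sub>R c t = c 0 + s *\<^sub>R w"
        using elim(3) by (simp add: ct scaleR_add_right scaleR_left_diff_distrib)
      finally show ?thesis
        using deriv[OF _ elim(2)[folded w_def], of "c 0 + s *\<^sub>R w"]
        by (simp add: h_def scaleR_add_left add.assoc)
    qed
    have "(h t - h 0) /\<^sub>R t \<in> V"
    proof (cases "t > 0")
      case True
      then show ?thesis
        using mean_value_convex_open[OF V(1,3), of 0 t h] hd by (simp add: divide_simps)
    next
      case False
      with elim(3) have "t < 0" by simp
      then have "(h 0 - h t) /\<^sub>R (0 - t) \<in> V"
        using hd by (intro mean_value_convex_open[OF V(1,3)]) (auto simp: divide_simps)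
      moreover have "(h 0 - h t) /\<^sub>R (0 - t) = (h t - h 0) /\<^sub>R t"
        by (simp add: scaleR_right_diff_distrib)
      ultimately show ?thesis by simp
    qed
    then show ?case using V(4) ct by (auto simp: h_def)
  qed
qed

section \<open>Tangent vectors as velocities of curves\<close>

text \<open>
  The part of the manifold axioms that concerns single charts.  It is enough for the source of a
  smooth map below, and it passes to products without computing higher derivatives of products of
  transition maps.
\<close>

definition charted :: "('m, 'e::real_vector) manifold \<Rightarrow> bool" where
  "charted M \<longleftrightarrow> locally_convex_space (model M) \<and>
     (\<forall>(U, \<phi>) \<in> atlas M. openin (mtop M) U \<and> openin (model M) (\<phi> ` U) \<and> inj_on \<phi> U)"

lemma chartedD:
  assumes "charted M" "(U, \<phi>) \<in> atlas M"
  shows "openin (mtop M) U" "openin (model M) (\<phi> ` U)" "inj_on \<phi> U"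
  using assms unfolding charted_def by auto

lemma charted_model: "charted M \<Longrightarrow> locally_convex_space (model M)"
  by (simp add: charted_def)

lemma smooth_manifold_chartD:
  assumes "smooth_manifold M" "(U, \<phi>) \<in> atlas M"
  shows "openin (mtop M) U" "openin (model M) (\<phi> ` U)"
    and "homeomorphic_map (subtopology (mtop M) U) (subtopology (model M) (\<phi> ` U)) \<phi>"
  using assms unfolding smooth_manifold_def by auto

lemma smooth_manifold_transition:
  assumes "smooth_manifold M" "(U, \<phi>) \<in> atlas M" "(V, \<psi>) \<in> atlas M"
  shows "lc_smooth_on (model M) (\<phi> ` (U \<inter> V)) (model M) (\<psi> \<circ> inv_into U \<phi>)"
proof -
  have "\<forall>(U, \<phi>)\<in>atlas M. \<forall>(V, \<psi>)\<in>atlas M.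
      lc_smooth_on (model M) (\<phi> ` (U \<inter> V)) (model M) (\<psi> \<circ> inv_into U \<phi>)"
    using assms(1) unfolding smooth_manifold_def by (elim conjE)
  from bspec[OF bspec[OF this assms(2), unfolded prod.case] assms(3)] show ?thesis by simp
qed

lemma smooth_manifold_imp_charted:
  assumes M: "smooth_manifold M"
  shows "charted M"
proof -
  have "inj_on \<phi> U" if c: "(U, \<phi>) \<in> atlas M" for U \<phi>
  proof -
    have "inj_on \<phi> (topspace (subtopology (mtop M) U))"
      using smooth_manifold_chartD(3)[OF M c] by (rule homeomorphic_imp_injective_map)
    moreover have "topspace (subtopology (mtop M) U) = U"
      using openin_subset[OF smooth_manifold_chartD(1)[OF M c]] by auto
    ultimately show ?thesis by simp
  qed
  then show ?thesis
    using M smooth_manifold_chartD(1,2)[OF M] unfolding charted_def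
    by (auto simp: smooth_manifold_def)
qed

lemma openin_chart_image:
  assumes M: "smooth_manifold M" and c: "(U, \<phi>) \<in> atlas M" and W: "openin (mtop M) W"
  shows "openin (model M) (\<phi> ` (U \<inter> W))"
proof -
  have "openin (subtopology (mtop M) U) (U \<inter> W)"
    using W by (simp add: openin_subtopology_Int2)
  then have "openin (subtopology (model M) (\<phi> ` U)) (\<phi> ` (U \<inter> W))"
    using homeomorphic_imp_open_map[OF smooth_manifold_chartD(3)[OF M c]]
    unfolding open_map_def by blast
  then show ?thesis
    using smooth_manifold_chartD(2)[OF M c] by (rule openin_trans_full)
qed

lemma charts_at_iff: "(U, \<phi>) \<in> charts_at M p \<longleftrightarrow> (U, \<phi>) \<in> atlas M \<and> p \<in> U"
  by (simp add: charts_at_def)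

lemma smooth_manifold_charts_at_nonempty:
  assumes "smooth_manifold M" "p \<in> topspace (mtop M)"
  shows "charts_at M p \<noteq> {}"
proof -
  have "p \<in> \<Union> (fst ` atlas M)" using assms by (simp add: smooth_manifold_def)
  then show ?thesis by (auto simp: charts_at_def)
qed

lemma tangent_spaceI:
  assumes "\<And>U \<phi>. (U, \<phi>) \<in> charts_at M x \<Longrightarrow> v (U, \<phi>) \<in> topspace (model M)"
    and "\<And>U \<phi> V \<psi>. (U, \<phi>) \<in> charts_at M x \<Longrightarrow> (V, \<psi>) \<in> charts_at M x \<Longrightarrow>
      v (V, \<psi>) = dir_deriv (model M) (\<phi> ` (U \<inter> V)) (\<psi> \<circ> inv_into U \<phi>) (\<phi> x) (v (U, \<phi>))"
    and "\<And>c. c \<notin> charts_at M x \<Longrightarrow> v c = 0"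
  shows "v \<in> tangent_space M x"
  unfolding tangent_space_def
proof (intro CollectI conjI)
  show "\<forall>c\<in>charts_at M x. v c \<in> topspace (model M)"
    using assms(1) by (simp add: split_paired_all Ball_def)
  show "\<forall>(U, \<phi>)\<in>charts_at M x. \<forall>(V, \<psi>)\<in>charts_at M x. v (V, \<psi>) =
      dir_deriv (model M) (\<phi> ` (U \<inter> V)) (\<psi> \<circ> inv_into U \<phi>) (\<phi> x) (v (U, \<phi>))"
    unfolding Ball_def split_paired_All prod.case by (intro allI impI) (rule assms(2))
  show "\<forall>c. c \<notin> charts_at M x \<longrightarrow> v c = 0"
    using assms(3) by (intro allI impI)
qed

lemma tangent_spaceD:
  assumes "v \<in> tangent_space M x"
  shows "(U, \<phi>) \<in> charts_at M x \<Longrightarrow> v (U, \<phi>) \<in> topspace (model M)"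
    and "(U, \<phi>) \<in> charts_at M x \<Longrightarrow> (V, \<psi>) \<in> charts_at M x \<Longrightarrow>
      v (V, \<psi>) = dir_deriv (model M) (\<phi> ` (U \<inter> V)) (\<psi> \<circ> inv_into U \<phi>) (\<phi> x) (v (U, \<phi>))"
    and "c \<notin> charts_at M x \<Longrightarrow> v c = 0"
proof -
  have *: "\<forall>c\<in>charts_at M x. v c \<in> topspace (model M)" "\<forall>c. c \<notin> charts_at M x \<longrightarrow> v c = 0"
    and **: "\<forall>(U, \<phi>)\<in>charts_at M x. \<forall>(V, \<psi>)\<in>charts_at M x. v (V, \<psi>) =
      dir_deriv (model M) (\<phi> ` (U \<inter> V)) (\<psi> \<circ> inv_into U \<phi>) (\<phi> x) (v (U, \<phi>))"
    using assms unfolding tangent_space_def by simp_all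
  show "(U, \<phi>) \<in> charts_at M x \<Longrightarrow> v (U, \<phi>) \<in> topspace (model M)"
    and "c \<notin> charts_at M x \<Longrightarrow> v c = 0"
    using * by blast+
  show "v (V, \<psi>) = dir_deriv (model M) (\<phi> ` (U \<inter> V)) (\<psi> \<circ> inv_into U \<phi>) (\<phi> x) (v (U, \<phi>))"
    if "(U, \<phi>) \<in> charts_at M x" "(V, \<psi>) \<in> charts_at M x"
    using bspec[OF bspec[OF ** that(1), unfolded prod.case] that(2)] by simp
qed

text \<open>
  The last conjunct is the normalisation of tangent vectors outside the charts at \<open>p\<close>; it makes the
  represented vector unique.
\<close>

definition represents ::
  "('m, 'e::real_vector) manifold \<Rightarrow> (real \<Rightarrow> 'm) \<Rightarrow> 'm \<Rightarrow> ('m, 'e) tvec \<Rightarrow> bool" where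
  "represents M \<gamma> p v \<longleftrightarrow>
     \<gamma> 0 = p \<and> limitin (mtop M) \<gamma> p (at 0) \<and>
     (\<forall>(U, \<phi>) \<in> charts_at M p. curve_deriv (model M) (\<phi> \<circ> \<gamma>) (v (U, \<phi>))) \<and>
     (\<forall>c. c \<notin> charts_at M p \<longrightarrow> v c = 0)"

lemma representsD:
  assumes "represents M \<gamma> p v"
  shows "\<gamma> 0 = p" "limitin (mtop M) \<gamma> p (at 0)"
    and "(U, \<phi>) \<in> charts_at M p \<Longrightarrow> curve_deriv (model M) (\<phi> \<circ> \<gamma>) (v (U, \<phi>))"
    and "c \<notin> charts_at M p \<Longrightarrow> v c = 0"
proof -
  have *: "\<gamma> 0 = p" "limitin (mtop M) \<gamma> p (at 0)" "\<forall>c. c \<notin> charts_at M p \<longrightarrow> v c = 0"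
    and **: "\<forall>(U, \<phi>)\<in>charts_at M p. curve_deriv (model M) (\<phi> \<circ> \<gamma>) (v (U, \<phi>))"
    using assms unfolding represents_def by simp_all
  show "\<gamma> 0 = p" "limitin (mtop M) \<gamma> p (at 0)" "c \<notin> charts_at M p \<Longrightarrow> v c = 0"
    using * by blast+
  show "curve_deriv (model M) (\<phi> \<circ> \<gamma>) (v (U, \<phi>))" if "(U, \<phi>) \<in> charts_at M p"
    using bspec[OF ** that] by simp
qed

lemma represents_unique:
  assumes M: "Hausdorff_space (model M)" and v: "represents M \<gamma> p v" and w: "represents M \<gamma> p w"
  shows "v = w"
proof
  fix c
  show "v c = w c"
  proof (cases "c \<in> charts_at M p")
    case True
    then have c: "(fst c, snd c) \<in> charts_at M p" by simp
    show ?thesis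
      using curve_deriv_unique[OF M representsD(3)[OF v c] representsD(3)[OF w c]] by simp
  next
    case False
    then show ?thesis using representsD(4)[OF v] representsD(4)[OF w] by simp
  qed
qed

lemma represents_cong:
  assumes ev: "eventually (\<lambda>t. \<gamma> t = \<delta> t) (at 0)" and 0: "\<gamma> 0 = \<delta> 0" and v: "represents M \<gamma> p v"
  shows "represents M \<delta> p v"
  unfolding represents_def
proof (intro conjI allI impI ballI)
  show "\<delta> 0 = p" using 0 representsD(1)[OF v] by simp
  show "limitin (mtop M) \<delta> p (at 0)"
    using ev representsD(2)[OF v] by (rule limitin_transform_eventually)
  show "v c = 0" if "c \<notin> charts_at M p" for c
    using representsD(4)[OF v that] .
  show "case c of (U, \<phi>) \<Rightarrow> curve_deriv (model M) (\<phi> \<circ> \<delta>) (v (U, \<phi>))" if "c \<in> charts_at M p" for c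
  proof (cases c)
    case (Pair U \<phi>)
    have "curve_deriv (model M) (\<phi> \<circ> \<delta>) (v (U, \<phi>))"
    proof (rule curve_deriv_cong[of "\<phi> \<circ> \<gamma>"])
      show "eventually (\<lambda>t. (\<phi> \<circ> \<gamma>) t = (\<phi> \<circ> \<delta>) t) (at 0)"
        using ev by eventually_elim simp
    qed (use 0 representsD(3)[OF v] that Pair in auto)
    then show ?thesis using Pair by simp
  qed
qed

lemma represents_const:
  assumes "locally_convex_space (model M)" "p \<in> topspace (mtop M)"
  shows "represents M (\<lambda>t. p) p 0"
  using assms by (auto simp: represents_def o_def curve_deriv_const)

text \<open>
  The chart representations of a velocity are compatible by the chain rule for the transition maps.
\<close>

lemma represents_imp_tangent:
  assumes M: "smooth_manifold M" and v: "represents M \<gamma> p v"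
  shows "v \<in> tangent_space M p"
proof (rule tangent_spaceI)
  note lc = charted_model[OF smooth_manifold_imp_charted[OF M]]
  note inj = chartedD(3)[OF smooth_manifold_imp_charted[OF M]]
  show "v c = 0" if "c \<notin> charts_at M p" for c
    using representsD(4)[OF v that] .
  show "v (U, \<phi>) \<in> topspace (model M)" if "(U, \<phi>) \<in> charts_at M p" for U \<phi>
    using representsD(3)[OF v that] unfolding curve_deriv_def by (rule limitin_topspace)
  fix U \<phi> V \<psi> assume cd: "(U, \<phi>) \<in> charts_at M p" "(V, \<psi>) \<in> charts_at M p"
  have U: "(U, \<phi>) \<in> atlas M" "p \<in> U" and V: "(V, \<psi>) \<in> atlas M" "p \<in> V"
    using cd by (auto simp: charts_at_iff)
  have "openin (model M) (\<phi> ` (U \<inter> V))"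
    by (rule openin_chart_image[OF M U(1) smooth_manifold_chartD(1)[OF M V(1)]])
  then have "curve_deriv (model M) ((\<psi> \<circ> inv_into U \<phi>) \<circ> (\<phi> \<circ> \<gamma>))
      (dir_deriv (model M) (\<phi> ` (U \<inter> V)) (\<psi> \<circ> inv_into U \<phi>) ((\<phi> \<circ> \<gamma>) 0) (v (U, \<phi>)))"
    by (rule chain_rule_curve[OF lc lc _ smooth_manifold_transition[OF M U(1) V(1)]
          representsD(3)[OF v cd(1)]])
       (use U V representsD(1)[OF v] in auto)
  moreover have "eventually (\<lambda>t. \<gamma> t \<in> U) (at 0)"
    using representsD(2)[OF v] smooth_manifold_chartD(1)[OF M U(1)] U(2) by (rule limitinD)
  then have "eventually (\<lambda>t. ((\<psi> \<circ> inv_into U \<phi>) \<circ> (\<phi> \<circ> \<gamma>)) t = (\<psi> \<circ> \<gamma>) t) (at 0)"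
    by eventually_elim (simp add: inj[OF U(1)])
  moreover have "((\<psi> \<circ> inv_into U \<phi>) \<circ> (\<phi> \<circ> \<gamma>)) 0 = (\<psi> \<circ> \<gamma>) 0"
    using representsD(1)[OF v] U(2) inj[OF U(1)] by simp
  ultimately have "curve_deriv (model M) (\<psi> \<circ> \<gamma>)
      (dir_deriv (model M) (\<phi> ` (U \<inter> V)) (\<psi> \<circ> inv_into U \<phi>) ((\<phi> \<circ> \<gamma>) 0) (v (U, \<phi>)))"
    by (rule curve_deriv_cong[rotated 2])
  then have "curve_deriv (model M) (\<psi> \<circ> \<gamma>)
      (dir_deriv (model M) (\<phi> ` (U \<inter> V)) (\<psi> \<circ> inv_into U \<phi>) (\<phi> p) (v (U, \<phi>)))"
    using representsD(1)[OF v] by simp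
  then show "v (V, \<psi>) = dir_deriv (model M) (\<phi> ` (U \<inter> V)) (\<psi> \<circ> inv_into U \<phi>) (\<phi> p) (v (U, \<phi>))"
    by (rule curve_deriv_unique[OF locally_convex_space_Hausdorff[OF lc]
          representsD(3)[OF v cd(2)]])
qed

text \<open>
  In the chart \<open>\<phi>\<close> the curve is a straight line; in another chart its derivative is the one prescribed
  by the compatibility condition on tangent vectors.
\<close>

lemma chart_line_represents:
  assumes M: "smooth_manifold M" and v: "v \<in> tangent_space M p" and c: "(U, \<phi>) \<in> charts_at M p"
  shows "represents M (\<lambda>t. inv_into U \<phi> (\<phi> p + t *\<^sub>R v (U, \<phi>))) p v"
  unfolding represents_def
proof (intro conjI allI impI ballI)
  let ?\<gamma> = "\<lambda>t. inv_into U \<phi> (\<phi> p + t *\<^sub>R v (U, \<phi>))"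
  note lc = charted_model[OF smooth_manifold_imp_charted[OF M]]
  have U: "(U, \<phi>) \<in> atlas M" "p \<in> U" using c by (auto simp: charts_at_iff)
  have inj: "inj_on \<phi> U" by (rule chartedD(3)[OF smooth_manifold_imp_charted[OF M] U(1)])
  have vE: "v (U, \<phi>) \<in> topspace (model M)"
    using v c by (rule tangent_spaceD(1))
  show "?\<gamma> 0 = p" using inj U(2) by simp
  show "v d = 0" if "d \<notin> charts_at M p" for d
    using v that by (rule tangent_spaceD(3))
  show "limitin (mtop M) ?\<gamma> p (at 0)"
    unfolding limitin_def
  proof (intro conjI allI impI)
    show "p \<in> topspace (mtop M)"
      using U(2) openin_subset[OF smooth_manifold_chartD(1)[OF M U(1)]] by blast
    fix W assume W: "openin (mtop M) W \<and> p \<in> W"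
    have "eventually (\<lambda>t. \<phi> p + t *\<^sub>R v (U, \<phi>) \<in> \<phi> ` (U \<inter> W)) (at 0)"
      by (rule eventually_line_in_open[OF lc openin_chart_image[OF M U(1)] _ vE]) (use W U in auto)
    then show "eventually (\<lambda>t. ?\<gamma> t \<in> W) (at 0)"
    proof eventually_elim
      case (elim t)
      then obtain y where "y \<in> U" "y \<in> W" "\<phi> p + t *\<^sub>R v (U, \<phi>) = \<phi> y" by auto
      then show ?case using inj by simp
    qed
  qed
  fix d assume d: "d \<in> charts_at M p"
  obtain V \<psi> where dV: "d = (V, \<psi>)" by (metis surj_pair)
  have V: "(V, \<psi>) \<in> atlas M" "p \<in> V" using d by (auto simp: dV charts_at_iff)
  have "curve_deriv (model M) (\<lambda>t. (\<psi> \<circ> inv_into U \<phi>) (\<phi> p + t *\<^sub>R v (U, \<phi>)))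
      (dir_deriv (model M) (\<phi> ` (U \<inter> V)) (\<psi> \<circ> inv_into U \<phi>) (\<phi> p) (v (U, \<phi>)))"
    by (rule lc_smooth_on_curve_deriv[OF lc locally_convex_space_Hausdorff[OF lc]
          openin_chart_image[OF M U(1) smooth_manifold_chartD(1)[OF M V(1)]]
          smooth_manifold_transition[OF M U(1) V(1)] _ vE])
       (use U V in auto)
  also have "dir_deriv (model M) (\<phi> ` (U \<inter> V)) (\<psi> \<circ> inv_into U \<phi>) (\<phi> p) (v (U, \<phi>)) = v (V, \<psi>)"
    using tangent_spaceD(2)[OF v c d[unfolded dV]] by simp
  finally show "case d of (V, \<psi>) \<Rightarrow> curve_deriv (model M) (\<psi> \<circ> ?\<gamma>) (v (V, \<psi>))"
    by (simp add: dV o_def)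
qed

lemma tangent_vector_represented:
  assumes "smooth_manifold M" "p \<in> topspace (mtop M)" "v \<in> tangent_space M p"
  obtains \<gamma> where "represents M \<gamma> p v"
  using chart_line_represents[OF assms(1,3)] smooth_manifold_charts_at_nonempty[OF assms(1,2)]
  by (metis ex_in_conv surj_pair)

text \<open>
  The tangent map is defined through a chosen chart \<open>(U, \<phi>)\<close> at \<open>p\<close>.  Near \<open>t = 0\<close> the curve
  \<open>f \<circ> \<gamma>\<close>, read in a chart \<open>\<psi>\<close>, is the smooth map \<open>\<psi> \<circ> f \<circ> \<phi>\<inverse>\<close> applied to \<open>\<phi> \<circ> \<gamma>\<close>, so the chain
  rule gives its derivative.
\<close>

theorem represents_smooth_image:
  assumes M: "charted M" and N: "smooth_manifold N" and f: "smooth_map M N f"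
    and p: "charts_at M p \<noteq> {}" and v: "represents M \<gamma> p v"
  shows "represents N (f \<circ> \<gamma>) (f p) (tangent_map M N f p v)"
proof -
  note lcM = charted_model[OF M]
  note lcN = charted_model[OF smooth_manifold_imp_charted[OF N]]
  obtain U \<phi> where c: "(SOME c. c \<in> charts_at M p) = (U, \<phi>)" by (metis surj_pair)
  have Up: "(U, \<phi>) \<in> charts_at M p"
    unfolding c[symmetric] by (rule someI_ex) (use p in auto)
  then have U: "(U, \<phi>) \<in> atlas M" "p \<in> U" by (auto simp: charts_at_iff)
  note inj = chartedD(3)[OF M U(1)]
  define f' where "f' = f \<circ> inv_into U \<phi>"
  have f': "smooth_into (model M) (\<phi> ` U) N f'"
    using f U(1) unfolding smooth_map_def f'_def by auto
  have cont: "continuous_map (subtopology (model M) (\<phi> ` U)) (mtop N) f'"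
    using f' by (simp add: smooth_into_def)
  have evU: "eventually (\<lambda>t. \<gamma> t \<in> U) (at 0)"
    using representsD(2)[OF v] chartedD(1)[OF M U(1)] U(2) by (rule limitinD)
  have eq: "eventually (\<lambda>t. f' (\<phi> (\<gamma> t)) = f (\<gamma> t)) (at 0)"
    using evU by eventually_elim (simp add: f'_def inj)
  have f'p: "f' (\<phi> p) = f p" using inj U(2) by (simp add: f'_def)
  have \<phi>\<gamma>: "curve_deriv (model M) (\<phi> \<circ> \<gamma>) (v (U, \<phi>))" by (rule representsD(3)[OF v Up])
  have "\<phi> p \<in> topspace (model M)" using U(2) openin_subset[OF chartedD(2)[OF M U(1)]] by blast
  then have "limitin (model M) (\<phi> \<circ> \<gamma>) (\<phi> p) (at 0)"
    using curve_deriv_imp_limit[OF lcM \<phi>\<gamma>] representsD(1)[OF v] by simp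
  then have "limitin (subtopology (model M) (\<phi> ` U)) (\<phi> \<circ> \<gamma>) (\<phi> p) (at 0)"
    using U(2) evU by (auto simp: limitin_subtopology elim: eventually_mono)
  from continuous_map_limit[OF cont this] have "limitin (mtop N) (\<lambda>t. f' (\<phi> (\<gamma> t))) (f p) (at 0)"
    by (simp add: o_def f'p)
  then have lim: "limitin (mtop N) (f \<circ> \<gamma>) (f p) (at 0)"
    unfolding o_def by (rule limitin_transform_eventually[OF eq])
  have deriv: "curve_deriv (model N) (\<psi> \<circ> (f \<circ> \<gamma>)) (tangent_map M N f p v (V, \<psi>))"
    if d: "(V, \<psi>) \<in> charts_at N (f p)" for V \<psi>
  proof -
    have V: "(V, \<psi>) \<in> atlas N" "f p \<in> V" using d by (auto simp: charts_at_iff)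
    \<comment> \<open>The left-hand domain occurs in the definition of smoothness, the right-hand one in that of the tangent map.\<close>
    have D: "\<phi> ` U \<inter> f' -` V = \<phi> ` (U \<inter> f -` V)"
      using inj by (auto simp: f'_def)
    have "openin (subtopology (model M) (\<phi> ` U))
        {x \<in> topspace (subtopology (model M) (\<phi> ` U)). f' x \<in> V}"
      using cont smooth_manifold_chartD(1)[OF N V(1)] by (rule openin_continuous_map_preimage)
    moreover have "{x \<in> topspace (subtopology (model M) (\<phi> ` U)). f' x \<in> V} = \<phi> ` U \<inter> f' -` V"
      using openin_subset[OF chartedD(2)[OF M U(1)]] by auto
    ultimately have "openin (model M) (\<phi> ` U \<inter> f' -` V)"
      using openin_trans_full[OF _ chartedD(2)[OF M U(1)]] by simp
    moreover have "lc_smooth_on (model M) (\<phi> ` U \<inter> f' -` V) (model N) (\<psi> \<circ> f')"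
      using f' V(1) unfolding smooth_into_def by auto
    ultimately have "curve_deriv (model N) ((\<psi> \<circ> f') \<circ> (\<phi> \<circ> \<gamma>))
        (dir_deriv (model N) (\<phi> ` U \<inter> f' -` V) (\<psi> \<circ> f') ((\<phi> \<circ> \<gamma>) 0) (v (U, \<phi>)))"
      by (rule chain_rule_curve[OF lcM lcN _ _ \<phi>\<gamma>])
         (use U(2) V(2) f'p representsD(1)[OF v] in auto)
    then have "curve_deriv (model N) (\<psi> \<circ> (f \<circ> \<gamma>))
        (dir_deriv (model N) (\<phi> ` U \<inter> f' -` V) (\<psi> \<circ> f') ((\<phi> \<circ> \<gamma>) 0) (v (U, \<phi>)))"
    proof (rule curve_deriv_cong[rotated -1])
      show "eventually (\<lambda>t. ((\<psi> \<circ> f') \<circ> (\<phi> \<circ> \<gamma>)) t = (\<psi> \<circ> (f \<circ> \<gamma>)) t) (at 0)"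
        using eq by eventually_elim simp
    qed (use f'p representsD(1)[OF v] in simp)
    then show ?thesis
      using d representsD(1)[OF v] unfolding tangent_map_def c D
      by (simp add: f'_def o_assoc)
  qed
  show ?thesis
    unfolding represents_def
    using lim deriv representsD(1)[OF v] by (auto simp: tangent_map_def c)
qed

text \<open>
  A map that is constant along the chart lines in direction \<open>v\<close> has tangent map zero on \<open>v\<close>.  The
  lemma serves to compute the tangent maps of the projections of a product.
\<close>

lemma tangent_map_eq_0:
  assumes M: "charted M" and N: "locally_convex_space (model N)" and p: "charts_at M p \<noteq> {}"
    and v: "\<And>U \<phi>. (U, \<phi>) \<in> charts_at M p \<Longrightarrow> v (U, \<phi>) \<in> topspace (model M)"
    and const: "\<And>U \<phi> t y. (U, \<phi>) \<in> charts_at M p \<Longrightarrow> y \<in> U \<Longrightarrow> \<phi> y = \<phi> p + t *\<^sub>R v (U, \<phi>) \<Longrightarrow> f y = f p"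
  shows "tangent_map M N f p v = 0"
proof -
  obtain U \<phi> where c: "(SOME c. c \<in> charts_at M p) = (U, \<phi>)" by (metis surj_pair)
  have Up: "(U, \<phi>) \<in> charts_at M p"
    unfolding c[symmetric] by (rule someI_ex) (use p in auto)
  then have U: "(U, \<phi>) \<in> atlas M" "p \<in> U" by (auto simp: charts_at_iff)
  note inj = chartedD(3)[OF M U(1)]
  have "eventually (\<lambda>t. \<phi> p + t *\<^sub>R v (U, \<phi>) \<in> \<phi> ` U) (at 0)"
    by (rule eventually_line_in_open[OF charted_model[OF M] chartedD(2)[OF M U(1)] _ v[OF Up]])
       (use U in auto)
  then have ev: "eventually (\<lambda>t. \<exists>y\<in>U. \<phi> y = \<phi> p + t *\<^sub>R v (U, \<phi>) \<and> f y = f p) (at 0)"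
  proof eventually_elim
    case (elim t)
    then obtain y where y: "y \<in> U" "\<phi> y = \<phi> p + t *\<^sub>R v (U, \<phi>)" by auto
    then show ?case using const[OF Up y] by blast
  qed
  have "dir_deriv (model N) (\<phi> ` (U \<inter> f -` V)) (\<psi> \<circ> f \<circ> inv_into U \<phi>) (\<phi> p) (v (U, \<phi>)) = 0"
    if d: "(V, \<psi>) \<in> charts_at N (f p)" for V \<psi>
  proof (rule dir_deriv_eqI)
    show "Hausdorff_space (model N)" using N by (rule locally_convex_space_Hausdorff)
    show "eventually (\<lambda>t. \<phi> p + t *\<^sub>R v (U, \<phi>) \<in> \<phi> ` (U \<inter> f -` V)) (at 0)"
      using ev by eventually_elim (use d in \<open>force simp: charts_at_iff\<close>)
    have "eventually (\<lambda>t. \<psi> (f p) = (\<psi> \<circ> f \<circ> inv_into U \<phi>) (\<phi> p + t *\<^sub>R v (U, \<phi>))) (at 0)"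
      using ev
    proof eventually_elim
      case (elim t)
      then obtain y where y: "y \<in> U" "\<phi> p + t *\<^sub>R v (U, \<phi>) = \<phi> y" "f y = f p" by metis
      show ?case using y inj by (simp add: y(2))
    qed
    then show "curve_deriv (model N) (\<lambda>t. (\<psi> \<circ> f \<circ> inv_into U \<phi>) (\<phi> p + t *\<^sub>R v (U, \<phi>))) 0"
      by (rule curve_deriv_cong[OF _ _ curve_deriv_const[OF N]]) (use inj U in simp)
  qed
  then show ?thesis
    by (auto simp: tangent_map_def c fun_eq_iff)
qed

section \<open>Tangent vectors of product manifolds\<close>

lemma charted_product:
  assumes M: "charted M" and N: "charted N"
  shows "charted (product_manifold M N)"
  unfolding charted_def
proof (intro conjI ballI)
  show "locally_convex_space (model (product_manifold M N))"
    by (simp add: product_manifold_def locally_convex_space_prod charted_model M N)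
  fix c assume "c \<in> atlas (product_manifold M N)"
  then obtain U \<phi> V \<psi> where c: "c = (U \<times> V, map_prod \<phi> \<psi>)"
    and U: "(U, \<phi>) \<in> atlas M" and V: "(V, \<psi>) \<in> atlas N"
    by (auto simp: product_manifold_def)
  show "case c of (W, \<theta>) \<Rightarrow> openin (mtop (product_manifold M N)) W \<and>
      openin (model (product_manifold M N)) (\<theta> ` W) \<and> inj_on \<theta> W"
    using chartedD[OF M U] chartedD[OF N V]
    by (simp add: c product_manifold_def openin_prod_Times_iff map_prod_inj_on
        map_prod_image)
qed

lemma charts_at_product:
  "c \<in> charts_at (product_manifold M N) (p, q) \<longleftrightarrow>
     (\<exists>U \<phi> V \<psi>. c = (U \<times> V, map_prod \<phi> \<psi>) \<and> (U, \<phi>) \<in> charts_at M p \<and> (V, \<psi>) \<in> charts_at N q)"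
  (is "?L \<longleftrightarrow> ?R")
proof
  assume ?L
  then obtain U \<phi> V \<psi> where "c = (U \<times> V, map_prod \<phi> \<psi>)" "(U, \<phi>) \<in> atlas M" "(V, \<psi>) \<in> atlas N"
    and "p \<in> U" "q \<in> V"
    by (auto simp: product_manifold_def charts_at_def)
  then show ?R unfolding charts_at_iff by blast
next
  assume ?R
  then show ?L by (auto simp: product_manifold_def charts_at_def)
qed

lemma charts_at_product_nonempty:
  assumes "smooth_manifold M" "smooth_manifold N" "p \<in> topspace (mtop M)" "q \<in> topspace (mtop N)"
  shows "charts_at (product_manifold M N) (p, q) \<noteq> {}"
proof -
  obtain c d where "c \<in> charts_at M p" "d \<in> charts_at N q"
    using smooth_manifold_charts_at_nonempty assms by (metis ex_in_conv)
  then have "(fst c \<times> fst d, map_prod (snd c) (snd d)) \<in> charts_at (product_manifold M N) (p, q)"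
    unfolding charts_at_product by (metis prod.collapse)
  then show ?thesis by blast
qed

text \<open>
  The pair of \<open>v\<close> and \<open>w\<close> as a tangent vector of the product.  A chart of the product is
  \<open>(U \<times> V, map_prod \<phi> \<psi>)\<close>; its factors are recovered from it as the projections of the domain and as
  the partial maps through the base point \<open>(p, q)\<close>.
\<close>

definition product_tvec ::
  "('m, 'e::real_vector) manifold \<Rightarrow> ('n, 'f::real_vector) manifold \<Rightarrow> 'm \<Rightarrow> 'n \<Rightarrow>
   ('m, 'e) tvec \<Rightarrow> ('n, 'f) tvec \<Rightarrow> ('m \<times> 'n, 'e \<times> 'f) tvec" where
  "product_tvec M N p q v w = (\<lambda>(W, \<theta>).
     if (W, \<theta>) \<in> charts_at (product_manifold M N) (p, q)
     then (v (fst ` W, \<lambda>x. fst (\<theta> (x, q))), w (snd ` W, \<lambda>y. snd (\<theta> (p, y)))) else 0)"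

lemma product_tvec_chart:
  assumes "(U, \<phi>) \<in> charts_at M p" "(V, \<psi>) \<in> charts_at N q"
  shows "product_tvec M N p q v w (U \<times> V, map_prod \<phi> \<psi>) = (v (U, \<phi>), w (V, \<psi>))"
proof -
  have "(U \<times> V, map_prod \<phi> \<psi>) \<in> charts_at (product_manifold M N) (p, q)"
    using assms by (auto simp: charts_at_product)
  moreover have "U \<noteq> {}" "V \<noteq> {}" using assms by (auto simp: charts_at_iff)
  ultimately show ?thesis by (simp add: product_tvec_def)
qed

lemma represents_product:
  assumes v: "represents M \<gamma> p v" and w: "represents N \<delta> q w"
  shows "represents (product_manifold M N) (\<lambda>t. (\<gamma> t, \<delta> t)) (p, q) (product_tvec M N p q v w)"
  unfolding represents_def
proof (intro conjI allI impI ballI)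
  show "(\<gamma> 0, \<delta> 0) = (p, q)" using representsD(1)[OF v] representsD(1)[OF w] by simp
  show "limitin (mtop (product_manifold M N)) (\<lambda>t. (\<gamma> t, \<delta> t)) (p, q) (at 0)"
    using representsD(2)[OF v] representsD(2)[OF w]
    by (simp add: product_manifold_def limitin_pairwise o_def)
  show "product_tvec M N p q v w c = 0" if "c \<notin> charts_at (product_manifold M N) (p, q)" for c
    using that by (cases c) (simp add: product_tvec_def)
  fix c assume "c \<in> charts_at (product_manifold M N) (p, q)"
  then obtain U \<phi> V \<psi> where c: "c = (U \<times> V, map_prod \<phi> \<psi>)"
    and U: "(U, \<phi>) \<in> charts_at M p" and V: "(V, \<psi>) \<in> charts_at N q"
    unfolding charts_at_product by blast
  have "curve_deriv (prod_topology (model M) (model N)) (\<lambda>t. (\<phi> (\<gamma> t), \<psi> (\<delta> t))) (v (U, \<phi>), w (V, \<psi>))"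
    using representsD(3)[OF v U] representsD(3)[OF w V] by (simp add: curve_deriv_pair o_def)
  then show "case c of (W, \<theta>) \<Rightarrow> curve_deriv (model (product_manifold M N))
      (\<theta> \<circ> (\<lambda>t. (\<gamma> t, \<delta> t))) (product_tvec M N p q v w (W, \<theta>))"
    by (simp add: c product_tvec_chart[OF U V] o_def) (simp add: product_manifold_def)
qed

text \<open>
  A transition map of the product is the product of two transition maps, so along a line its
  derivative is computed componentwise; each component is the derivative of a chart line.
\<close>

lemma product_tvec_tangent:
  assumes M: "smooth_manifold M" and N: "smooth_manifold N"
    and v: "v \<in> tangent_space M p" and w: "w \<in> tangent_space N q"
  shows "product_tvec M N p q v w \<in> tangent_space (product_manifold M N) (p, q)"
proof (rule tangent_spaceI)
  let ?P = "product_manifold M N" and ?X = "product_tvec M N p q v w"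
  have model: "model ?P = prod_topology (model M) (model N)" by (simp add: product_manifold_def)
  note lcM = charted_model[OF smooth_manifold_imp_charted[OF M]]
  note lcN = charted_model[OF smooth_manifold_imp_charted[OF N]]
  note lcP = locally_convex_space_prod[OF lcM lcN]
  note injM = chartedD(3)[OF smooth_manifold_imp_charted[OF M]]
  note injN = chartedD(3)[OF smooth_manifold_imp_charted[OF N]]
  show "?X c = 0" if "c \<notin> charts_at ?P (p, q)" for c
    using that by (cases c) (simp add: product_tvec_def)
  show "?X (W, \<theta>) \<in> topspace (model ?P)" if "(W, \<theta>) \<in> charts_at ?P (p, q)" for W \<theta>
    using that tangent_spaceD(1)[OF v] tangent_spaceD(1)[OF w] unfolding charts_at_product
    by (auto simp: product_tvec_chart model)
  fix W \<theta> W' \<theta>' assume "(W, \<theta>) \<in> charts_at ?P (p, q)" "(W', \<theta>') \<in> charts_at ?P (p, q)"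
  then obtain U \<phi> V \<psi> U' \<phi>' V' \<psi>'
    where c: "W = U \<times> V" "\<theta> = map_prod \<phi> \<psi>" and c': "W' = U' \<times> V'" "\<theta>' = map_prod \<phi>' \<psi>'"
      and Up: "(U, \<phi>) \<in> charts_at M p" and Vq: "(V, \<psi>) \<in> charts_at N q"
      and U'p: "(U', \<phi>') \<in> charts_at M p" and V'q: "(V', \<psi>') \<in> charts_at N q"
    unfolding charts_at_product prod.inject by metis
  have U: "(U, \<phi>) \<in> atlas M" "p \<in> U" and V: "(V, \<psi>) \<in> atlas N" "q \<in> V"
    and U': "(U', \<phi>') \<in> atlas M" "p \<in> U'" and V': "(V', \<psi>') \<in> atlas N" "q \<in> V'"
    using Up Vq U'p V'q by (auto simp: charts_at_iff)
  define a where "a = v (U, \<phi>)"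
  define b where "b = w (V, \<psi>)"
  have ab: "a \<in> topspace (model M)" "b \<in> topspace (model N)"
    using tangent_spaceD(1)[OF v Up] tangent_spaceD(1)[OF w Vq] by (auto simp: a_def b_def)
  let ?D = "\<phi> ` (U \<inter> U') \<times> \<psi> ` (V \<inter> V')"
  have D: "\<theta> ` (W \<inter> W') = ?D"
    by (simp add: c c' Times_Int_Times map_prod_image)
  have openD: "openin (model ?P) ?D"
    by (simp add: model openin_prod_Times_iff openin_chart_image M N U V
        smooth_manifold_chartD(1)[OF M U'(1)] smooth_manifold_chartD(1)[OF N V'(1)])
  have ev: "eventually (\<lambda>t. (\<phi> p, \<psi> q) + t *\<^sub>R (a, b) \<in> ?D) (at 0)"
    by (rule eventually_line_in_open[OF _ openD])
       (use U V U' V' ab in \<open>auto simp: model lcP\<close>)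
  have inj: "inj_on \<theta> W"
    unfolding c using injM[OF U(1)] injN[OF V(1)] by (rule map_prod_inj_on)
  let ?c = "\<lambda>t. (\<phi>' (inv_into U \<phi> (\<phi> p + t *\<^sub>R a)), \<psi>' (inv_into V \<psi> (\<psi> q + t *\<^sub>R b)))"
  have split: "?c t = (\<theta>' \<circ> inv_into W \<theta>) ((\<phi> p, \<psi> q) + t *\<^sub>R (a, b))"
    if tD: "(\<phi> p, \<psi> q) + t *\<^sub>R (a, b) \<in> ?D" for t
  proof -
    obtain x y where xy: "x \<in> U" "\<phi> p + t *\<^sub>R a = \<phi> x" "y \<in> V" "\<psi> q + t *\<^sub>R b = \<psi> y"
      using tD unfolding scaleR_Pair add_Pair mem_Times_iff fst_conv snd_conv by blast
    have "(\<phi> p, \<psi> q) + t *\<^sub>R (a, b) = \<theta> (x, y)" using xy by (simp add: c)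
    then show ?thesis
      using xy injM[OF U(1)] injN[OF V(1)] inv_into_f_f[OF inj, of "(x, y)"] by (simp add: c c')
  qed
  have "curve_deriv (model M) (\<lambda>t. \<phi>' (inv_into U \<phi> (\<phi> p + t *\<^sub>R a))) (v (U', \<phi>'))"
    using representsD(3)[OF chart_line_represents[OF M v Up] U'p] by (simp add: o_def a_def)
  moreover have "curve_deriv (model N) (\<lambda>t. \<psi>' (inv_into V \<psi> (\<psi> q + t *\<^sub>R b))) (w (V', \<psi>'))"
    using representsD(3)[OF chart_line_represents[OF N w Vq] V'q] by (simp add: o_def b_def)
  ultimately have deriv: "curve_deriv (model ?P) ?c (v (U', \<phi>'), w (V', \<psi>'))"
    by (simp add: model curve_deriv_pair)
  have "dir_deriv (model ?P) ?D (\<theta>' \<circ> inv_into W \<theta>) (\<phi> p, \<psi> q) (a, b) = (v (U', \<phi>'), w (V', \<psi>'))"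
  proof (rule dir_deriv_eqI[OF _ ev])
    show "Hausdorff_space (model ?P)" unfolding model using lcP by (rule locally_convex_space_Hausdorff)
    show "curve_deriv (model ?P) (\<lambda>t. (\<theta>' \<circ> inv_into W \<theta>) ((\<phi> p, \<psi> q) + t *\<^sub>R (a, b)))
        (v (U', \<phi>'), w (V', \<psi>'))"
    proof (rule curve_deriv_cong[OF _ _ deriv])
      show "eventually (\<lambda>t. ?c t = (\<theta>' \<circ> inv_into W \<theta>) ((\<phi> p, \<psi> q) + t *\<^sub>R (a, b))) (at 0)"
        using ev by eventually_elim (rule split)
      show "?c 0 = (\<theta>' \<circ> inv_into W \<theta>) ((\<phi> p, \<psi> q) + 0 *\<^sub>R (a, b))"
        by (rule split) (use U U' V V' in auto)
    qed
  qed
  then show "?X (W', \<theta>') = dir_deriv (model ?P) (\<theta> ` (W \<inter> W')) (\<theta>' \<circ> inv_into W \<theta>) (\<theta> (p, q)) (?X (W, \<theta>))"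
    unfolding D by (simp add: c c' product_tvec_chart Up Vq U'p V'q a_def b_def)
qed

lemma tangent_map_fst_vertical:
  assumes M: "smooth_manifold M" and N: "smooth_manifold N"
    and p: "p \<in> topspace (mtop M)" and q: "q \<in> topspace (mtop N)" and w: "w \<in> tangent_space N q"
  shows "tangent_map (product_manifold M N) M fst (p, q) (product_tvec M N p q 0 w) = 0"
proof (rule tangent_map_eq_0)
  note chM = smooth_manifold_imp_charted[OF M] and chN = smooth_manifold_imp_charted[OF N]
  show "charted (product_manifold M N)" using chM chN by (rule charted_product)
  show "locally_convex_space (model M)" using chM by (rule charted_model)
  show "charts_at (product_manifold M N) (p, q) \<noteq> {}"
    using M N p q by (rule charts_at_product_nonempty)
  have "0 \<in> tangent_space M p"
    by (rule represents_imp_tangent[OF M represents_const[OF charted_model[OF chM] p]])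
  note X = product_tvec_tangent[OF M N this w]
  fix W \<theta> assume W: "(W, \<theta>) \<in> charts_at (product_manifold M N) (p, q)"
  show "product_tvec M N p q 0 w (W, \<theta>) \<in> topspace (model (product_manifold M N))"
    using X W by (rule tangent_spaceD(1))
  fix t y assume y: "y \<in> W" "\<theta> y = \<theta> (p, q) + t *\<^sub>R product_tvec M N p q 0 w (W, \<theta>)"
  obtain U \<phi> V \<psi> where c: "W = U \<times> V" "\<theta> = map_prod \<phi> \<psi>"
    and U: "(U, \<phi>) \<in> charts_at M p" and V: "(V, \<psi>) \<in> charts_at N q"
    using W unfolding charts_at_product prod.inject by metis
  have "\<phi> (fst y) = \<phi> p" using y(2) by (cases y) (simp add: c product_tvec_chart[OF U V])
  moreover have "inj_on \<phi> U" "fst y \<in> U" "p \<in> U"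
    using chartedD(3)[OF chM] U y(1) by (auto simp: c charts_at_iff)
  ultimately show "fst y = fst (p, q)"
    by (simp add: inj_on_eq_iff)
qed

lemma tangent_map_snd_horizontal:
  assumes M: "smooth_manifold M" and N: "smooth_manifold N"
    and p: "p \<in> topspace (mtop M)" and q: "q \<in> topspace (mtop N)" and v: "v \<in> tangent_space M p"
  shows "tangent_map (product_manifold M N) N snd (p, q) (product_tvec M N p q v 0) = 0"
proof (rule tangent_map_eq_0)
  note chM = smooth_manifold_imp_charted[OF M] and chN = smooth_manifold_imp_charted[OF N]
  show "charted (product_manifold M N)" using chM chN by (rule charted_product)
  show "locally_convex_space (model N)" using chN by (rule charted_model)
  show "charts_at (product_manifold M N) (p, q) \<noteq> {}"
    using M N p q by (rule charts_at_product_nonempty)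
  have "0 \<in> tangent_space N q"
    by (rule represents_imp_tangent[OF N represents_const[OF charted_model[OF chN] q]])
  note X = product_tvec_tangent[OF M N v this]
  fix W \<theta> assume W: "(W, \<theta>) \<in> charts_at (product_manifold M N) (p, q)"
  show "product_tvec M N p q v 0 (W, \<theta>) \<in> topspace (model (product_manifold M N))"
    using X W by (rule tangent_spaceD(1))
  fix t y assume y: "y \<in> W" "\<theta> y = \<theta> (p, q) + t *\<^sub>R product_tvec M N p q v 0 (W, \<theta>)"
  obtain U \<phi> V \<psi> where c: "W = U \<times> V" "\<theta> = map_prod \<phi> \<psi>"
    and U: "(U, \<phi>) \<in> charts_at M p" and V: "(V, \<psi>) \<in> charts_at N q"
    using W unfolding charts_at_product prod.inject by metis
  have "\<psi> (snd y) = \<psi> q" using y(2) by (cases y) (simp add: c product_tvec_chart[OF U V])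
  moreover have "inj_on \<psi> V" "snd y \<in> V" "q \<in> V"
    using chartedD(3)[OF chN] V y(1) by (auto simp: c charts_at_iff)
  ultimately show "snd y = snd (p, q)"
    by (simp add: inj_on_eq_iff)
qed

section \<open>Primitive forms\<close>

text \<open>
  On tangent vectors this is linearity; on all other arguments the value is 0 by the normalisation of
  forms.
\<close>

lemma two_form_zero:
  assumes \<eta>: "two_form M \<eta>"
  shows "\<eta> x 0 w = 0" "\<eta> x v 0 = 0"
proof -
  let ?T = "tangent_space M x"
  have out: "\<eta> x v w = 0" if "\<not> (x \<in> topspace (mtop M) \<and> v \<in> ?T \<and> w \<in> ?T)" for v w
    using \<eta>[unfolded two_form_def, THEN conjunct1] that by blast
  have lin: "\<eta> x (r *\<^sub>R u + s *\<^sub>R v) w = r * \<eta> x u w + s * \<eta> x v w \<and>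
      \<eta> x w (r *\<^sub>R u + s *\<^sub>R v) = r * \<eta> x w u + s * \<eta> x w v"
    if "x \<in> topspace (mtop M)" "u \<in> ?T" "v \<in> ?T" "w \<in> ?T" for u v w r s
    using \<eta>[unfolded two_form_def, THEN conjunct2, THEN conjunct1, THEN bspec, OF that(1),
        THEN conjunct1] that(2-4) by blast
  have "\<eta> x 0 w = 0 \<and> \<eta> x w 0 = 0" for w
  proof (cases "x \<in> topspace (mtop M) \<and> 0 \<in> ?T \<and> w \<in> ?T")
    case True
    then show ?thesis using lin[of 0 0 w 0 0] by simp
  next
    case False
    then show ?thesis using out by blast
  qed
  then show "\<eta> x 0 w = 0" "\<eta> x v 0 = 0" by auto
qed

theorem corollary1p2:
  fixes G :: "'g monoid"
    and M :: "('g, 'e::real_vector) manifold"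
    and \<eta> :: "('g, 'e) form2"
  assumes "lie_group G M"
    and "milnor_regular G M"
    and "two_form M \<eta>"
    and "primitive_form G M \<eta>"
  shows "\<eta> = 0"
proof (intro ext)
  fix g v w
  let ?P = "product_manifold M M" and ?e = "\<one>\<^bsub>G\<^esub>"
  define m where "m = (\<lambda>(x, y). x \<otimes>\<^bsub>G\<^esub> y)"
  interpret group G using assms(1) by (simp add: lie_group_def)
  have M: "smooth_manifold M" and top: "topspace (mtop M) = carrier G" and m: "smooth_map ?P M m"
    using assms(1) by (simp_all add: lie_group_def m_def)
  note chM = smooth_manifold_imp_charted[OF M]
  note lc = charted_model[OF chM]
  note chP = charted_product[OF chM chM]
  have topP: "topspace (mtop ?P) = carrier G \<times> carrier G"
    by (simp add: product_manifold_def top)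
  have "\<eta> g v w = 0"
  proof (cases "g \<in> topspace (mtop M) \<and> v \<in> tangent_space M g \<and> w \<in> tangent_space M g")
    case False
    then show ?thesis using assms(3)[unfolded two_form_def, THEN conjunct1] by blast
  next
    case True
    then have g: "g \<in> carrier G" and v: "v \<in> tangent_space M g" and w: "w \<in> tangent_space M g"
      by (simp_all add: top)
    \<comment> \<open>The tangent map of the multiplication is computed by multiplying curves pointwise.\<close>
    have push: "represents M (\<lambda>t. \<alpha> t \<otimes>\<^bsub>G\<^esub> \<beta> t) (a \<otimes>\<^bsub>G\<^esub> b) (tangent_map ?P M m (a, b) (product_tvec M M a b x y))"
      if "a \<in> carrier G" "b \<in> carrier G" "represents M \<alpha> a x" "represents M \<beta> b y" for \<alpha> \<beta> a b x y
      using represents_smooth_image[OF chP M m charts_at_product_nonempty[OF M M]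
          represents_product[OF that(3,4)]] that(1,2)
      by (simp add: m_def top o_def)
    have const: "represents M (\<lambda>t. a) a 0" if "a \<in> carrier G" for a
      using lc that by (intro represents_const) (simp_all add: top)
    have near: "eventually (\<lambda>t. \<alpha> t \<in> carrier G) (at 0)" if "represents M \<alpha> a x" for \<alpha> a x
      using limitinD[OF representsD(2)[OF that] openin_topspace]
        limitin_topspace[OF representsD(2)[OF that]] by (simp add: top)
    obtain \<gamma> where \<gamma>: "represents M \<gamma> g v"
      using tangent_vector_represented[OF M _ v] g top by blast
    obtain \<delta> where \<delta>: "represents M \<delta> g w"
      using tangent_vector_represented[OF M _ w] g top by blast
    \<comment> \<open>\<open>X = (v, 0)\<close> is mapped to \<open>v\<close>, as \<open>\<gamma>\<close> times the constant curve \<open>e\<close> is \<open>\<gamma>\<close>.\<close>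
    define X where "X = product_tvec M M g ?e v 0"
    have "represents M (\<lambda>t. \<gamma> t \<otimes>\<^bsub>G\<^esub> ?e) g (tangent_map ?P M m (g, ?e) X)"
      using push[OF g one_closed \<gamma> const[OF one_closed]] g by (simp add: X_def)
    then have "represents M \<gamma> g (tangent_map ?P M m (g, ?e) X)"
    proof (rule represents_cong[rotated 2])
      show "eventually (\<lambda>t. \<gamma> t \<otimes>\<^bsub>G\<^esub> ?e = \<gamma> t) (at 0)"
        using near[OF \<gamma>] by eventually_elim simp
    qed (use representsD(1)[OF \<gamma>] g in simp)
    then have mX: "tangent_map ?P M m (g, ?e) X = v"
      by (rule represents_unique[OF locally_convex_space_Hausdorff[OF lc] _ \<gamma>])
    \<comment> \<open>\<open>u\<close> is the left translate of \<open>w\<close> to the unit element.\<close>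
    define u where "u = tangent_map ?P M m (inv\<^bsub>G\<^esub> g, g) (product_tvec M M (inv\<^bsub>G\<^esub> g) g 0 w)"
    have u: "represents M (\<lambda>t. inv\<^bsub>G\<^esub> g \<otimes>\<^bsub>G\<^esub> \<delta> t) ?e u"
      using push[OF _ g const \<delta>, of "inv\<^bsub>G\<^esub> g"] g by (simp add: u_def)
    \<comment> \<open>\<open>Y = (0, u)\<close> is mapped to \<open>w\<close>, as translating back from the unit element recovers \<open>\<delta>\<close>.\<close>
    define Y where "Y = product_tvec M M g ?e 0 u"
    have "represents M (\<lambda>t. g \<otimes>\<^bsub>G\<^esub> (inv\<^bsub>G\<^esub> g \<otimes>\<^bsub>G\<^esub> \<delta> t)) g (tangent_map ?P M m (g, ?e) Y)"
      using push[OF g one_closed const[OF g] u] g by (simp add: Y_def)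
    then have "represents M \<delta> g (tangent_map ?P M m (g, ?e) Y)"
    proof (rule represents_cong[rotated 2])
      show "eventually (\<lambda>t. g \<otimes>\<^bsub>G\<^esub> (inv\<^bsub>G\<^esub> g \<otimes>\<^bsub>G\<^esub> \<delta> t) = \<delta> t) (at 0)"
        using near[OF \<delta>] by eventually_elim (simp add: g m_assoc[symmetric])
    qed (use representsD(1)[OF \<delta>] g in \<open>simp add: m_assoc[symmetric]\<close>)
    then have mY: "tangent_map ?P M m (g, ?e) Y = w"
      by (rule represents_unique[OF locally_convex_space_Hausdorff[OF lc] _ \<delta>])
    have u_tangent: "u \<in> tangent_space M ?e" using M u by (rule represents_imp_tangent)
    have zero: "0 \<in> tangent_space M a" if "a \<in> carrier G" for a
      using M const[OF that] by (rule represents_imp_tangent)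
    have X: "X \<in> tangent_space ?P (g, ?e)"
      unfolding X_def using M M v zero[OF one_closed] by (rule product_tvec_tangent)
    have Y: "Y \<in> tangent_space ?P (g, ?e)"
      unfolding Y_def using M M zero[OF g] u_tangent by (rule product_tvec_tangent)
    have sndX: "tangent_map ?P M snd (g, ?e) X = 0"
      unfolding X_def by (rule tangent_map_snd_horizontal[OF M M _ _ v]) (simp_all add: top g)
    have fstY: "tangent_map ?P M fst (g, ?e) Y = 0"
      unfolding Y_def by (rule tangent_map_fst_vertical[OF M M _ _ u_tangent]) (simp_all add: top g)
    have "pullback_form ?P M m \<eta> (g, ?e) X Y =
        pullback_form ?P M fst \<eta> (g, ?e) X Y + pullback_form ?P M snd \<eta> (g, ?e) X Y"
      using assms(4) by (simp add: primitive_form_def m_def)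
    then have "\<eta> (m (g, ?e)) v w =
        \<eta> g (tangent_map ?P M fst (g, ?e) X) 0 + \<eta> ?e 0 (tangent_map ?P M snd (g, ?e) Y)"
      using g X Y by (simp add: pullback_form_def topP mX mY sndX fstY)
    then show ?thesis
      using g by (simp add: m_def two_form_zero[OF assms(3)])
  qed
  then show "\<eta> g v w = 0 g v w" by simp
qed

end
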